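(* Let $G$ be a real, connected, compact, semisimple Lie group, and let $\mathcal{X}$ be a linear vector field on $G$ with linear flow $\varphi_t$. Then every periodic orbit of $\varphi_t$ is stable.
   Context: A vector field $\mathcal{X}$ on a Lie group $G$ is called linear if its flow $(\varphi_t)_{t\in\mathbb{R}}$ is a family of automorphisms of the Lie group $G$; $\varphi_t$ is then called the linear flow of $\mathcal{X}$. A periodic orbit is an orbit $\{\varphi_t(g):t\in\mathbb{R}\}$ for which there is $s>0$ with $\varphi_{t+s}(g)=\varphi_t(g)$ for all $t$. A periodic orbit $\Gamma$ of $\varphi_t$ is stable if for each open set $V$ containing $\Gamma$ there is an open set $W\subset V$ containing $\Gamma$ such that every solution (orbit of $\varphi_t$) starting at a point of $W$ at $t=0$ stays in $V$ for all $t\ge 0$. *)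

theory Defs
  imports "HOL-Analysis.Analysis" "HOL-Library.Function_Algebras"
begin

section \<open>Functions into a real vector space form a real vector space\<close>

instantiation "fun" :: (type, real_vector) real_vector
begin

definition scaleR_fun :: "real \<Rightarrow> ('a \<Rightarrow> 'b) \<Rightarrow> 'a \<Rightarrow> 'b" where
  "scaleR_fun r f = (\<lambda>x. r *\<^sub>R f x)"

instance
  by standard (auto simp: scaleR_fun_def fun_eq_iff plus_fun_def scaleR_add_left scaleR_add_right)

end

section \<open>Smooth functions between Euclidean spaces\<close>

text \<open>Used for open \<open>S\<close> and finite-dimensional domains only, where it is the usual \<open>C\<^sup>k\<close>: the
  directional derivatives are functions of the base point that are again \<open>C\<^sup>k\<close>.\<close>

primrec Ck_on :: "nat \<Rightarrow> 'a::real_normed_vector set \<Rightarrow> ('a \<Rightarrow> 'b::real_normed_vector) \<Rightarrow> bool" where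
  "Ck_on 0 S f \<longleftrightarrow> continuous_on S f"
| "Ck_on (Suc k) S f \<longleftrightarrow> (\<forall>x\<in>S. f differentiable (at x)) \<and>
     (\<forall>v. Ck_on k S (\<lambda>x. frechet_derivative f (at x) v))"

definition smooth_on :: "'a::real_normed_vector set \<Rightarrow> ('a \<Rightarrow> 'b::real_normed_vector) \<Rightarrow> bool" where
  "smooth_on S f \<longleftrightarrow> (\<forall>k. Ck_on k S f)"

section \<open>Smooth manifolds\<close>

text \<open>A chart is its domain together with the coordinate map; the values of the map outside the
  domain are irrelevant. The underlying set of the manifold is the whole type \<open>'g\<close>, and an atlas
  need not be maximal. Second countability and the Hausdorff property are imposed on \<open>'g\<close> by
  type classes where manifolds are considered.\<close>

type_synonym ('g, 'e) chart = "'g set \<times> ('g \<Rightarrow> 'e)"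

definition smooth_atlas ::
    "('g::{second_countable_topology, t2_space}, 'e::euclidean_space) chart set \<Rightarrow> bool" where
  "smooth_atlas A \<longleftrightarrow>
     (\<Union>(U, f)\<in>A. U) = UNIV \<and>
     (\<forall>(U, f)\<in>A. open U \<and> open (f ` U) \<and> homeomorphism U (f ` U) f (inv_into U f)) \<and>
     (\<forall>(U, f)\<in>A. \<forall>(V, g)\<in>A. smooth_on (f ` (U \<inter> V)) (g \<circ> inv_into U f))"

definition prod_atlas ::
    "('g, 'e) chart set \<Rightarrow> ('h, 'd) chart set \<Rightarrow> ('g \<times> 'h, 'e \<times> 'd) chart set" where
  "prod_atlas A B = {(U \<times> V, map_prod f g) | U f V g. (U, f) \<in> A \<and> (V, g) \<in> B}"

definition smooth_map ::
    "('g::topological_space, 'e::euclidean_space) chart set \<Rightarrow>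
     ('h::topological_space, 'd::euclidean_space) chart set \<Rightarrow> ('g \<Rightarrow> 'h) \<Rightarrow> bool" where
  "smooth_map A B F \<longleftrightarrow> continuous_on UNIV F \<and>
     (\<forall>(U, f)\<in>A. \<forall>(V, g)\<in>B. smooth_on (f ` (U \<inter> F -` V)) (g \<circ> F \<circ> inv_into U f))"

text \<open>The differential of \<open>F\<close> at \<open>p\<close>, in a chart \<open>c\<close> around \<open>p\<close> and a chart \<open>d\<close> around \<open>F p\<close>.\<close>

definition chart_deriv ::
    "('g, 'e::euclidean_space) chart \<Rightarrow> ('h, 'd::euclidean_space) chart \<Rightarrow> ('g \<Rightarrow> 'h) \<Rightarrow> 'g \<Rightarrow> 'e \<Rightarrow> 'd"
  where
  "chart_deriv c d F p =
     frechet_derivative (snd d \<circ> F \<circ> inv_into (fst c) (snd c)) (at (snd c p))"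

section \<open>Vector fields\<close>

text \<open>A tangent vector at \<open>p\<close> is given by its coordinate vectors in all charts around \<open>p\<close>, related
  by the derivatives of the coordinate changes. A vector field \<open>X\<close> thus has the coordinate vector
  \<open>X c p\<close> at \<open>p\<close> in the chart \<open>c\<close>; the irrelevant values of \<open>X\<close> are set to \<open>0\<close>, so that equality of
  vector fields is equality of functions and their vector space operations are pointwise.\<close>

type_synonym ('g, 'e) vfield = "('g, 'e) chart \<Rightarrow> 'g \<Rightarrow> 'e"

definition smooth_vector_field ::
    "('g::topological_space, 'e::euclidean_space) chart set \<Rightarrow> ('g, 'e) vfield \<Rightarrow> bool" where
  "smooth_vector_field A X \<longleftrightarrow>
     (\<forall>c p. \<not> (c \<in> A \<and> p \<in> fst c) \<longrightarrow> X c p = 0) \<and>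
     (\<forall>c\<in>A. \<forall>d\<in>A. \<forall>p\<in>fst c \<inter> fst d. X d p = chart_deriv c d id p (X c p)) \<and>
     (\<forall>(U, f)\<in>A. smooth_on (f ` U) (X (U, f) \<circ> inv_into U f))"

text \<open>In coordinates, \<open>[X, Y] = DY(X) - DX(Y)\<close>.\<close>

definition lie_bracket ::
    "('g, 'e::euclidean_space) chart set \<Rightarrow> ('g, 'e) vfield \<Rightarrow> ('g, 'e) vfield \<Rightarrow> ('g, 'e) vfield" where
  "lie_bracket A X Y = (\<lambda>c p. if c \<in> A \<and> p \<in> fst c then
       frechet_derivative (Y c \<circ> inv_into (fst c) (snd c)) (at (snd c p)) (X c p) -
       frechet_derivative (X c \<circ> inv_into (fst c) (snd c)) (at (snd c p)) (Y c p)
     else 0)"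

definition integral_curve ::
    "('g::topological_space, 'e::euclidean_space) chart set \<Rightarrow> ('g, 'e) vfield \<Rightarrow> (real \<Rightarrow> 'g) \<Rightarrow> bool" where
  "integral_curve A X \<gamma> \<longleftrightarrow> continuous_on UNIV \<gamma> \<and>
     (\<forall>t. \<forall>(U, f)\<in>A. \<gamma> t \<in> U \<longrightarrow>
       ((f \<circ> \<gamma>) has_vector_derivative X (U, f) (\<gamma> t)) (at t))"

definition flow_of ::
    "('g::topological_space, 'e::euclidean_space) chart set \<Rightarrow> ('g, 'e) vfield \<Rightarrow>
     (real \<Rightarrow> 'g \<Rightarrow> 'g) \<Rightarrow> bool" where
  "flow_of A X \<phi> \<longleftrightarrow>
     \<phi> 0 = id \<and> (\<forall>s t. \<phi> (s + t) = \<phi> s \<circ> \<phi> t) \<and>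
     (\<forall>g. integral_curve A X (\<lambda>t. \<phi> t g))"

section \<open>Semisimple Lie algebras\<close>

text \<open>Here \<open>L\<close> is a Lie algebra with bracket \<open>br\<close>, given as a subspace of an ambient real vector
  space. It is semisimple if its radical, the largest solvable ideal, is zero.\<close>

definition lie_ideal ::
    "('v::real_vector \<Rightarrow> 'v \<Rightarrow> 'v) \<Rightarrow> 'v set \<Rightarrow> 'v set \<Rightarrow> bool" where
  "lie_ideal br L I \<longleftrightarrow> subspace I \<and> I \<subseteq> L \<and> (\<forall>x\<in>L. \<forall>y\<in>I. br x y \<in> I)"

primrec derived_series ::
    "('v::real_vector \<Rightarrow> 'v \<Rightarrow> 'v) \<Rightarrow> 'v set \<Rightarrow> nat \<Rightarrow> 'v set" where
  "derived_series br I 0 = I"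
| "derived_series br I (Suc k) =
     span {br x y | x y. x \<in> derived_series br I k \<and> y \<in> derived_series br I k}"

definition lie_solvable :: "('v::real_vector \<Rightarrow> 'v \<Rightarrow> 'v) \<Rightarrow> 'v set \<Rightarrow> bool" where
  "lie_solvable br I \<longleftrightarrow> (\<exists>k. derived_series br I k = {0})"

definition semisimple_lie_algebra ::
    "('v::real_vector \<Rightarrow> 'v \<Rightarrow> 'v) \<Rightarrow> 'v set \<Rightarrow> bool" where
  "semisimple_lie_algebra br L \<longleftrightarrow>
     (\<forall>I. lie_ideal br L I \<and> lie_solvable br I \<longrightarrow> I = {0})"

section \<open>Lie groups\<close>

locale lie_group = Groups.group gmult gunit ginv
  for gmult :: "'g \<Rightarrow> 'g \<Rightarrow> 'g::{second_countable_topology, t2_space}" (infixl "\<odot>" 70)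
    and gunit :: 'g
    and ginv :: "'g \<Rightarrow> 'g" +
  fixes A :: "('g, 'e::euclidean_space) chart set"
  assumes smooth_atlas: "smooth_atlas A"
    and smooth_mult: "smooth_map (prod_atlas A A) A (\<lambda>(x, y). x \<odot> y)"
    and smooth_inverse: "smooth_map A A ginv"

definition left_invariant_fields ::
    "('g::topological_space \<Rightarrow> 'g \<Rightarrow> 'g) \<Rightarrow> ('g, 'e::euclidean_space) chart set \<Rightarrow> ('g, 'e) vfield set"
  where
  "left_invariant_fields gmult A = {X. smooth_vector_field A X \<and>
     (\<forall>g p. \<forall>c\<in>A. \<forall>d\<in>A. p \<in> fst c \<and> gmult g p \<in> fst d \<longrightarrow>
       X d (gmult g p) = chart_deriv c d (gmult g) p (X c p))}"

definition semisimple_lie_group ::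
    "('g::topological_space \<Rightarrow> 'g \<Rightarrow> 'g) \<Rightarrow> ('g, 'e::euclidean_space) chart set \<Rightarrow> bool" where
  "semisimple_lie_group gmult A \<longleftrightarrow>
     semisimple_lie_algebra (lie_bracket A) (left_invariant_fields gmult A)"

definition lie_group_automorphism ::
    "('g::topological_space \<Rightarrow> 'g \<Rightarrow> 'g) \<Rightarrow> ('g, 'e::euclidean_space) chart set \<Rightarrow> ('g \<Rightarrow> 'g) \<Rightarrow> bool"
  where
  "lie_group_automorphism gmult A F \<longleftrightarrow>
     bij F \<and> (\<forall>x y. F (gmult x y) = gmult (F x) (F y)) \<and>
     smooth_map A A F \<and> smooth_map A A (inv F)"

text \<open>\<open>linear_flow gmult A X \<phi>\<close>: the vector field \<open>X\<close> is linear, and \<open>\<phi>\<close> is its linear flow.\<close>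

definition linear_flow ::
    "('g::topological_space \<Rightarrow> 'g \<Rightarrow> 'g) \<Rightarrow> ('g, 'e::euclidean_space) chart set \<Rightarrow>
     ('g, 'e) vfield \<Rightarrow> (real \<Rightarrow> 'g \<Rightarrow> 'g) \<Rightarrow> bool" where
  "linear_flow gmult A X \<phi> \<longleftrightarrow> flow_of A X \<phi> \<and> (\<forall>t. lie_group_automorphism gmult A (\<phi> t))"

definition linear_vector_field ::
    "('g::topological_space \<Rightarrow> 'g \<Rightarrow> 'g) \<Rightarrow> ('g, 'e::euclidean_space) chart set \<Rightarrow>
     ('g, 'e) vfield \<Rightarrow> bool" where
  "linear_vector_field gmult A X \<longleftrightarrow> smooth_vector_field A X \<and> (\<exists>\<phi>. linear_flow gmult A X \<phi>)"

section \<open>Periodic orbits and stability\<close>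

definition periodic_orbit :: "(real \<Rightarrow> 'g \<Rightarrow> 'g) \<Rightarrow> 'g set \<Rightarrow> bool" where
  "periodic_orbit \<phi> \<Gamma> \<longleftrightarrow>
     (\<exists>g. \<Gamma> = range (\<lambda>t. \<phi> t g) \<and> (\<exists>s>0. \<forall>t. \<phi> (t + s) g = \<phi> t g))"

definition stable_orbit :: "(real \<Rightarrow> 'g \<Rightarrow> 'g::topological_space) \<Rightarrow> 'g set \<Rightarrow> bool" where
  "stable_orbit \<phi> \<Gamma> \<longleftrightarrow>
     (\<forall>V. open V \<and> \<Gamma> \<subseteq> V \<longrightarrow>
       (\<exists>W. open W \<and> \<Gamma> \<subseteq> W \<and> W \<subseteq> V \<and> (\<forall>x\<in>W. \<forall>t\<ge>0. \<phi> t x \<in> V)))"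

end

theory Submission
  imports Defs
begin

text \<open>All \<open>\<phi> t\<close> are automorphisms, so \<open>Ad (\<phi> t g)\<close> is conjugate to \<open>Ad g\<close> and the functions
  \<open>g \<mapsto> tr (Ad g)^k\<close> are constant along the flow. Since \<open>Ad G\<close> is bounded, all these traces being maximal
  forces \<open>Ad g = id\<close>; since \<open>G\<close> is semisimple, this happens near the unit only at the unit, as a limit
  direction of the kernel of \<open>Ad\<close> would span an abelian ideal. Hence the unit has arbitrarily small
  neighbourhoods whose orbits stay small, and left translation along a compact orbit \<open>\<Gamma>\<close> carries them
  to neighbourhoods of \<open>\<Gamma>\<close>.\<close>

section \<open>Iterated derivatives\<close>

text \<open>Near the unit the flow enters only through continuous orbits with
  \<open>\<phi> 0 = id\<close> and through each \<open>\<phi> t\<close> being an automorphism; it is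
  never identified with a flow of conjugations. An invariant function therefore need not separate
  points, only detect the unit. Two obstacles shape the proof. Traces cannot tell a unipotent map
  from the identity, since all its powers have the trace of the identity. Boundedness of the powers,
  which comes from compactness of the group, excludes this; averaging the powers on the range of
  \<open>Ad g - id\<close> does so without complex eigenvalues. Secondly, nontrivial elements of the
  kernel of \<open>Ad\<close> near the unit come without a curve to differentiate along. A limit of
  their normalised chart coordinates replaces the tangent vector. The bracket is then read off from
  a mixed second derivative of the multiplication in charts, which is why symmetry of second
  derivatives is needed.\<close>

lemma mixed_difference_eq:
  fixes f :: "'a::real_normed_vector \<Rightarrow> real"
  assumes f': "\<And>x. x \<in> S \<Longrightarrow> (f has_derivative f' x) (at x)"
    and f'': "\<And>x. x \<in> S \<Longrightarrow> ((\<lambda>x. f' x u) has_derivative f'' x) (at x)"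
    and "s > 0"
    and S: "\<And>a b. 0 \<le> a \<Longrightarrow> a \<le> s \<Longrightarrow> 0 \<le> b \<Longrightarrow> b \<le> s \<Longrightarrow> p + a *\<^sub>R u + b *\<^sub>R v \<in> S"
  shows "\<exists>a b. 0 \<le> a \<and> a \<le> s \<and> 0 \<le> b \<and> b \<le> s \<and>
     f (p + s *\<^sub>R u + s *\<^sub>R v) - f (p + s *\<^sub>R u) - f (p + s *\<^sub>R v) + f p
       = s * (s * f'' (p + a *\<^sub>R u + b *\<^sub>R v) v)"
proof -
  \<comment> \<open>The double difference is an increment of \<open>G\<close>, which is itself an
    increment in direction \<open>v\<close>; the mean value theorem is applied first along
    \<open>u\<close>, then along \<open>v\<close>. The term \<open>0 *\<^sub>R v\<close> lets
    \<open>lin\<close> cover both summands.\<close>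
  define G where "G = (\<lambda>a. f (p + a *\<^sub>R u + s *\<^sub>R v) - f (p + a *\<^sub>R u + 0 *\<^sub>R v))"
  have lin: "((\<lambda>a. f (p + a *\<^sub>R u + b *\<^sub>R v)) has_real_derivative f' (p + a *\<^sub>R u + b *\<^sub>R v) u) (at a)"
    if "0 \<le> a" "a \<le> s" "0 \<le> b" "b \<le> s" for a b
  proof -
    have "((\<lambda>a. p + a *\<^sub>R u + b *\<^sub>R v) has_derivative (\<lambda>h. h *\<^sub>R u)) (at a)"
      by (auto intro!: derivative_eq_intros)
    from has_derivative_compose[OF this f'[OF S[OF that]]]
    have D: "((\<lambda>a. f (p + a *\<^sub>R u + b *\<^sub>R v)) has_derivative (\<lambda>h. f' (p + a *\<^sub>R u + b *\<^sub>R v) (h *\<^sub>R u))) (at a)" .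
    have "(\<lambda>h. f' (p + a *\<^sub>R u + b *\<^sub>R v) (h *\<^sub>R u)) = (*) (f' (p + a *\<^sub>R u + b *\<^sub>R v) u)"
      using linear_cmul[OF has_derivative_linear[OF f'[OF S[OF that]]]] by auto
    with D show ?thesis
      by (simp add: has_field_derivative_def)
  qed
  have "\<exists>a::real. a > 0 \<and> a < s \<and> G s - G 0 = (s - 0) * (f' (p + a *\<^sub>R u + s *\<^sub>R v) u - f' (p + a *\<^sub>R u + 0 *\<^sub>R v) u)"
  proof (rule MVT2[OF \<open>s > 0\<close>])
    fix x assume "0 \<le> x" "x \<le> s"
    then show "(G has_real_derivative f' (p + x *\<^sub>R u + s *\<^sub>R v) u - f' (p + x *\<^sub>R u + 0 *\<^sub>R v) u) (at x)"
      unfolding G_def using \<open>s > 0\<close> by (intro DERIV_diff lin) auto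
  qed
  then obtain a where a: "0 < a" "a < s"
    and Ga: "G s - G 0 = s * (f' (p + a *\<^sub>R u + s *\<^sub>R v) u - f' (p + a *\<^sub>R u + 0 *\<^sub>R v) u)"
    by auto
  have "\<exists>b::real. b > 0 \<and> b < s \<and> f' (p + a *\<^sub>R u + s *\<^sub>R v) u - f' (p + a *\<^sub>R u + 0 *\<^sub>R v) u
      = (s - 0) * f'' (p + a *\<^sub>R u + b *\<^sub>R v) v"
  proof (rule MVT2[OF \<open>s > 0\<close>, where f = "\<lambda>b. f' (p + a *\<^sub>R u + b *\<^sub>R v) u"])
    fix b assume b: "0 \<le> b" "b \<le> s"
    have mem: "p + a *\<^sub>R u + b *\<^sub>R v \<in> S" using a b by (intro S) auto
    have "((\<lambda>b. p + a *\<^sub>R u + b *\<^sub>R v) has_derivative (\<lambda>h. h *\<^sub>R v)) (at b)"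
      by (auto intro!: derivative_eq_intros)
    from has_derivative_compose[OF this f''[OF mem]]
    have D: "((\<lambda>b. f' (p + a *\<^sub>R u + b *\<^sub>R v) u) has_derivative (\<lambda>h. f'' (p + a *\<^sub>R u + b *\<^sub>R v) (h *\<^sub>R v))) (at b)" .
    have "(\<lambda>h. f'' (p + a *\<^sub>R u + b *\<^sub>R v) (h *\<^sub>R v)) = (*) (f'' (p + a *\<^sub>R u + b *\<^sub>R v) v)"
      using linear_cmul[OF has_derivative_linear[OF f''[OF mem]]] by auto
    with D show "((\<lambda>b. f' (p + a *\<^sub>R u + b *\<^sub>R v) u) has_real_derivative f'' (p + a *\<^sub>R u + b *\<^sub>R v) v) (at b)"
      by (simp add: has_field_derivative_def)
  qed
  then obtain b where b: "0 < b" "b < s"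
    and "f' (p + a *\<^sub>R u + s *\<^sub>R v) u - f' (p + a *\<^sub>R u + 0 *\<^sub>R v) u = s * f'' (p + a *\<^sub>R u + b *\<^sub>R v) v"
    by auto
  with Ga have "G s - G 0 = s * (s * f'' (p + a *\<^sub>R u + b *\<^sub>R v) v)" by simp
  then show ?thesis using a b unfolding G_def
    by (intro exI[of _ a] exI[of _ b]) (auto simp: algebra_simps)
qed

text \<open>\<open>frechet_derivative\<close> chooses among all derivatives. Functions that agree
  near \<open>x\<close> have the same derivatives there, so the choices coincide even if none
  exists.\<close>

lemma frechet_derivative_transform_open:
  assumes "open S" "x \<in> S" "\<And>y. y \<in> S \<Longrightarrow> f y = g y"
  shows "frechet_derivative f (at x) = frechet_derivative g (at x)"
proof -
  have "(f has_derivative D) (at x) \<longleftrightarrow> (g has_derivative D) (at x)" for D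
    using assms has_derivative_transform_within_open[of f D x UNIV S g]
      has_derivative_transform_within_open[of g D x UNIV S f] by auto
  then show ?thesis by (simp add: frechet_derivative_def)
qed

lemma Ck_on_cong:
  assumes "open S" "\<And>x. x \<in> S \<Longrightarrow> f x = g x" "Ck_on k S f"
  shows "Ck_on k S g"
  using assms(2,3)
proof (induction k arbitrary: f g)
  case 0
  then show ?case by (simp cong: continuous_on_cong)
next
  case (Suc k)
  have "g differentiable (at x)" if "x \<in> S" for x
    using Suc.prems(2) differentiableI[OF has_derivative_transform_within_open[OF _ assms(1) that Suc.prems(1)]] that
    by (auto simp: differentiable_def)
  moreover have "Ck_on k S (\<lambda>x. frechet_derivative g (at x) v)" for v
  proof (rule Suc.IH)
    show "frechet_derivative f (at x) v = frechet_derivative g (at x) v" if "x \<in> S" for x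
      by (rule fun_cong[OF frechet_derivative_transform_open[OF assms(1) that Suc.prems(1)]])
    show "Ck_on k S (\<lambda>x. frechet_derivative f (at x) v)"
      using Suc.prems(2) by simp
  qed
  ultimately show ?case by simp
qed

text \<open>The derivative of the slice in direction \<open>v\<close> is the slice of the derivative
  in direction \<open>(v, 0)\<close>, so the induction stays within slices.\<close>

lemma Ck_on_slice:
  fixes f :: "'a::real_normed_vector \<times> 'b::real_normed_vector \<Rightarrow> 'c::real_normed_vector"
  assumes "Ck_on k S f" "open T" "\<And>x. x \<in> T \<Longrightarrow> (x, a) \<in> S"
  shows "Ck_on k T (\<lambda>x. f (x, a))"
  using assms(1)
proof (induction k arbitrary: f)
  case 0
  then show ?case
    using assms(3) by (auto intro!: continuous_on_compose2[of S f] continuous_intros)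
next
  case (Suc k)
  have D: "((\<lambda>x. f (x, a)) has_derivative (\<lambda>h. frechet_derivative f (at (x, a)) (h, 0))) (at x)"
    if "x \<in> T" for x
  proof -
    have "f differentiable (at (x, a))" using Suc.prems assms(3)[OF that] by simp
    then have "(f has_derivative frechet_derivative f (at (x, a))) (at (x, a))"
      by (simp add: frechet_derivative_works)
    moreover have "((\<lambda>x. (x, a)) has_derivative (\<lambda>h. (h, 0))) (at x)"
      by (auto intro!: derivative_eq_intros)
    ultimately show ?thesis using has_derivative_compose by fastforce
  qed
  have "Ck_on k T (\<lambda>x. frechet_derivative (\<lambda>x. f (x, a)) (at x) v)" for v
  proof (rule Ck_on_cong[OF assms(2)])
    show "Ck_on k T (\<lambda>x. frechet_derivative f (at (x, a)) (v, 0))"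
      using Suc.prems by (intro Suc.IH) simp
    show "frechet_derivative f (at (x, a)) (v, 0) = frechet_derivative (\<lambda>x. f (x, a)) (at x) v"
      if "x \<in> T" for x
      by (rule fun_cong[OF frechet_derivative_at[OF D[OF that]]])
  qed
  then show ?case using differentiableI[OF D] by simp
qed

text \<open>Schwarz's theorem. The double difference over a small parallelogram is symmetric in
  \<open>u\<close> and \<open>v\<close>, and equals \<open>s * s\<close> times either mixed
  derivative at some point nearby; continuity moves both points to \<open>p\<close>.\<close>

lemma frechet_derivative_commute:
  fixes f :: "'a::real_normed_vector \<Rightarrow> 'b::real_inner"
  assumes "open S" "p \<in> S" "Ck_on 2 S f"
  shows "frechet_derivative (\<lambda>x. frechet_derivative f (at x) u) (at p) v =
    frechet_derivative (\<lambda>x. frechet_derivative f (at x) v) (at p) u"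
proof -
  define f' where "f' = (\<lambda>x. frechet_derivative f (at x))"
  define f'' where "f'' = (\<lambda>u x. frechet_derivative (\<lambda>x. f' x u) (at x))"
  have C: "Ck_on (Suc (Suc 0)) S f" using assms(3) by (simp only: numeral_2_eq_2)
  have f': "(f has_derivative f' x) (at x)" if "x \<in> S" for x
    using C that by (auto simp: f'_def simp flip: frechet_derivative_works)
  have f'': "((\<lambda>x. f' x u) has_derivative f'' u x) (at x)" if "x \<in> S" for x u
    using C that by (auto simp: f'_def f''_def simp flip: frechet_derivative_works)
  have cont: "continuous_on S (\<lambda>x. f'' u x v)" for u v
    using C by (auto simp: f'_def f''_def)
  \<comment> \<open>Pairing with a fixed vector gives real-valued functions, for which the mean
    value theorem is exact. With the defect itself as that vector, a vanishing pairing means that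
    the defect is zero.\<close>
  define w where "w = f'' u p v - f'' v p u"
  have fw': "((\<lambda>x. f x \<bullet> w) has_derivative (\<lambda>h. f' x h \<bullet> w)) (at x)" if "x \<in> S" for x
    using f'[OF that] by (rule has_derivative_inner_left)
  have fw'': "((\<lambda>x. f' x u \<bullet> w) has_derivative (\<lambda>h. f'' u x h \<bullet> w)) (at x)" if "x \<in> S" for x u
    using f''[OF that] by (rule has_derivative_inner_left)
  have "\<bar>f'' u p v \<bullet> w - f'' v p u \<bullet> w\<bar> \<le> 2 * e" if "e > 0" for e
  proof -
    have "\<forall>\<^sub>F x in nhds p. dist (f'' u x v \<bullet> w) (f'' u p v \<bullet> w) < e" for u v
    proof -
      have "isCont (\<lambda>x. f'' u x v \<bullet> w) p"
        using cont[of u v] assms(1,2) by (intro continuous_intros) (auto simp: continuous_on_eq_continuous_at)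
      then have "((\<lambda>x. f'' u x v \<bullet> w) \<longlongrightarrow> f'' u p v \<bullet> w) (nhds p)"
        by (simp add: isCont_def tendsto_nhds_iff)
      then show ?thesis using that by (rule tendstoD)
    qed
    from this[of u v] this[of v u] eventually_nhds_in_open[OF assms(1,2)]
    have "\<forall>\<^sub>F x in nhds p. dist (f'' u x v \<bullet> w) (f'' u p v \<bullet> w) < e
      \<and> dist (f'' v x u \<bullet> w) (f'' v p u \<bullet> w) < e \<and> x \<in> S"
      by eventually_elim auto
    then obtain d where d: "d > 0" and near: "\<And>x. dist x p < d \<Longrightarrow>
        dist (f'' u x v \<bullet> w) (f'' u p v \<bullet> w) < e
      \<and> dist (f'' v x u \<bullet> w) (f'' v p u \<bullet> w) < e \<and> x \<in> S"
      by (auto simp: eventually_nhds_metric)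
    \<comment> \<open>Keeps the whole parallelogram within \<open>d / 2\<close> of \<open>p\<close>;
      the summand 1 guards against \<open>u = v = 0\<close>.\<close>
    define s where "s = d / (2 * (norm u + norm v + 1))"
    have nn: "norm u + norm v + 1 > 0" by (smt (verit) norm_ge_zero)
    have s: "s > 0" using d nn unfolding s_def by (intro divide_pos_pos mult_pos_pos) auto
    have close: "dist (p + a *\<^sub>R u + b *\<^sub>R v) p < d" "dist (p + a *\<^sub>R v + b *\<^sub>R u) p < d"
      if "0 \<le> a" "a \<le> s" "0 \<le> b" "b \<le> s" for a b
    proof -
      have *: "norm (a *\<^sub>R u + b *\<^sub>R v) < d" if "0 \<le> a" "a \<le> s" "0 \<le> b" "b \<le> s" for a b
      proof -
        have "norm (a *\<^sub>R u + b *\<^sub>R v) \<le> a * norm u + b * norm v"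
          using that by (intro norm_triangle_le) auto
        also have "\<dots> \<le> s * norm u + s * norm v"
          using that by (intro add_mono mult_right_mono) auto
        also have "\<dots> \<le> s * (norm u + norm v + 1)" using s by (simp add: algebra_simps)
        also have "\<dots> = d / 2" using nn by (simp add: s_def field_simps)
        also have "\<dots> < d" using d by simp
        finally show ?thesis .
      qed
      from *[OF that] *[OF that(3,4,1,2)]
      show "dist (p + a *\<^sub>R u + b *\<^sub>R v) p < d" "dist (p + a *\<^sub>R v + b *\<^sub>R u) p < d"
        by (simp_all add: dist_norm add.assoc add.commute[of "b *\<^sub>R u"])
    qed
    obtain a b where ab: "0 \<le> a" "a \<le> s" "0 \<le> b" "b \<le> s"
      and E1: "f (p + s *\<^sub>R u + s *\<^sub>R v) \<bullet> w - f (p + s *\<^sub>R u) \<bullet> w - f (p + s *\<^sub>R v) \<bullet> w + f p \<bullet> w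
       = s * (s * (f'' u (p + a *\<^sub>R u + b *\<^sub>R v) v \<bullet> w))"
      using mixed_difference_eq[OF fw' fw'' s, of S p u v] close near by metis
    obtain a' b' where ab': "0 \<le> a'" "a' \<le> s" "0 \<le> b'" "b' \<le> s"
      and E2: "f (p + s *\<^sub>R v + s *\<^sub>R u) \<bullet> w - f (p + s *\<^sub>R v) \<bullet> w - f (p + s *\<^sub>R u) \<bullet> w + f p \<bullet> w
       = s * (s * (f'' v (p + a' *\<^sub>R v + b' *\<^sub>R u) u \<bullet> w))"
      using mixed_difference_eq[OF fw' fw'' s, of S p v u] close near by metis
    have "p + s *\<^sub>R v + s *\<^sub>R u = p + s *\<^sub>R u + s *\<^sub>R v" by simp
    with E1 E2 have "s * (s * (f'' u (p + a *\<^sub>R u + b *\<^sub>R v) v \<bullet> w)) = s * (s * (f'' v (p + a' *\<^sub>R v + b' *\<^sub>R u) u \<bullet> w))"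
      by (smt (verit))
    then have "f'' u (p + a *\<^sub>R u + b *\<^sub>R v) v \<bullet> w = f'' v (p + a' *\<^sub>R v + b' *\<^sub>R u) u \<bullet> w"
      using s by simp
    with near[OF close(1)[OF ab]] near[OF close(2)[OF ab']] show ?thesis
      by (auto simp: dist_real_def)
  qed
  from this[of "e / 2" for e] have "\<bar>f'' u p v \<bullet> w - f'' v p u \<bullet> w\<bar> \<le> 0 + e" if "e > 0" for e
    using that by simp
  then have "\<bar>f'' u p v \<bullet> w - f'' v p u \<bullet> w\<bar> \<le> 0" by (rule field_le_epsilon)
  then have "w \<bullet> w = 0" by (simp add: w_def inner_diff_left)
  then show ?thesis by (simp add: w_def f''_def f'_def)
qed

text \<open>At the zeros \<open>x n\<close> the remainder quotient reduces to minus
  \<open>f'\<close> of the normalised direction, so it tends both to 0 and to \<open>- f' v\<close>.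
  The points need not lie on any curve.\<close>

lemma has_derivative_vanishes_along_sequence:
  fixes f :: "'a::real_normed_vector \<Rightarrow> 'b::real_normed_vector"
  assumes f: "(f has_derivative f') (at a)" and "f a = 0"
    and x: "\<And>n. x n \<noteq> a" "x \<longlonglongrightarrow> a" "\<forall>\<^sub>F n in sequentially. f (x n) = 0"
    and v: "(\<lambda>n. (x n - a) /\<^sub>R norm (x n - a)) \<longlonglongrightarrow> v"
  shows "f' v = 0"
proof -
  have "((\<lambda>y. (f y - f a - f' (y - a)) /\<^sub>R norm (y - a)) \<longlongrightarrow> 0) (at a)"
    using f by (simp add: has_derivative_at_within)
  moreover have "filterlim x (at a) sequentially"
    using x by (simp add: filterlim_at)
  ultimately have "(\<lambda>n. (f (x n) - f a - f' (x n - a)) /\<^sub>R norm (x n - a)) \<longlonglongrightarrow> 0"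
    by (rule filterlim_compose)
  moreover have "\<forall>\<^sub>F n in sequentially. (f (x n) - f a - f' (x n - a)) /\<^sub>R norm (x n - a)
      = - f' ((x n - a) /\<^sub>R norm (x n - a))"
    using x(3) by eventually_elim (simp add: assms(2) linear_cmul[OF has_derivative_linear[OF f]])
  ultimately have "(\<lambda>n. - f' ((x n - a) /\<^sub>R norm (x n - a))) \<longlonglongrightarrow> 0"
    by (rule Lim_transform_eventually)
  moreover have "(\<lambda>n. - f' ((x n - a) /\<^sub>R norm (x n - a))) \<longlonglongrightarrow> - f' v"
    by (intro tendsto_minus bounded_linear.tendsto[OF has_derivative_bounded_linear[OF f]] v)
  ultimately have "- f' v = 0" using LIMSEQ_unique by blast
  then show ?thesis by simp
qed

section \<open>Traces of power-bounded maps\<close>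

definition lin_trace :: "('a::euclidean_space \<Rightarrow> 'a) \<Rightarrow> real" where
  "lin_trace f = (\<Sum>b\<in>Basis. f b \<bullet> b)"

lemma linear_eq_sum_Basis: "linear f \<Longrightarrow> f x = (\<Sum>b\<in>Basis. (x \<bullet> b) *\<^sub>R f b)"
  for f :: "'a::euclidean_space \<Rightarrow> 'b::real_vector"
  by (metis (no_types, lifting) euclidean_representation linear_cmul linear_sum sum.cong)

lemma lin_trace_comp_commute:
  fixes f :: "'b::euclidean_space \<Rightarrow> 'a::euclidean_space"
  assumes "linear f" "linear g"
  shows "lin_trace (\<lambda>x. f (g x)) = lin_trace (\<lambda>x. g (f x))"
proof -
  have "lin_trace (\<lambda>x. f (g x)) = (\<Sum>b\<in>Basis. \<Sum>c\<in>Basis. (g b \<bullet> c) * (f c \<bullet> b))"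
    by (simp add: lin_trace_def linear_eq_sum_Basis[OF assms(1), of "g _"] inner_sum_left)
  also have "\<dots> = (\<Sum>c\<in>Basis. \<Sum>b\<in>Basis. (f c \<bullet> b) * (g b \<bullet> c))"
    by (subst sum.swap) (simp add: mult.commute)
  also have "\<dots> = lin_trace (\<lambda>x. g (f x))"
    by (simp add: lin_trace_def linear_eq_sum_Basis[OF assms(2), of "f _"] inner_sum_left)
  finally show ?thesis .
qed

text \<open>Directions orthogonal to the range contribute nothing to the trace, so an orthonormal
  basis of any subspace containing the range suffices.\<close>

lemma lin_trace_eq_sum_orthonormal:
  fixes f :: "'a::euclidean_space \<Rightarrow> 'a"
  assumes "linear f" "finite B" "pairwise orthogonal B" "\<And>b. b \<in> B \<Longrightarrow> norm b = 1"
    and "range f \<subseteq> span B"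
  shows "lin_trace f = (\<Sum>b\<in>B. f b \<bullet> b)"
proof -
  have "lin_trace f = (\<Sum>c\<in>Basis. (\<Sum>b\<in>B. (f c \<bullet> b) *\<^sub>R b) \<bullet> c)"
    unfolding lin_trace_def using assms(5) 
    by (intro sum.cong refl arg_cong2[where f = inner] orthonormal_basis_expand[symmetric] assms) auto
  also have "\<dots> = (\<Sum>b\<in>B. (\<Sum>c\<in>Basis. (b \<bullet> c) *\<^sub>R f c) \<bullet> b)"
    by (simp add: inner_sum_left mult.commute) (rule sum.swap)
  also have "\<dots> = (\<Sum>b\<in>B. f b \<bullet> b)"
    by (simp flip: linear_eq_sum_Basis[OF assms(1)])
  finally show ?thesis .
qed

lemma linear_funpow: "linear f \<Longrightarrow> linear (f ^^ k)"
  for f :: "'a::real_vector \<Rightarrow> 'a"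
  by (induction k) (auto intro: linear_compose linear_id simp: id_def[symmetric])

text \<open>On an orthonormal basis of the range of \<open>T - id\<close> the diagonal entries of the powers of \<open>T\<close>
  sum up to its size, but their Cesaro means tend to 0.\<close>

lemma eq_id_if_power_bounded_if_trace_maximal:
  fixes T :: "'a::euclidean_space \<Rightarrow> 'a"
  assumes T: "linear T"
    and bounded: "\<And>k x. norm ((T ^^ k) x) \<le> C * norm x"
    and trace: "\<And>k. lin_trace (T ^^ k) = DIM('a)"
  shows "T x = x"
proof -
  define S where "S = range (\<lambda>x. T x - x)"
  have linS: "linear (\<lambda>x. T x - x)"
    using T by (intro linear_compose_sub linear_ident)
  have S: "subspace S"
    unfolding S_def using linear_subspace_image[OF linS subspace_UNIV] .
  obtain B where B: "B \<subseteq> S" "pairwise orthogonal B" "\<And>b. b \<in> B \<Longrightarrow> norm b = 1"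
    "independent B" "span B = S"
    using orthonormal_basis_subspace[OF S] by metis
  have fin: "finite B" using B(4) independent_imp_finite by blast
  \<comment> \<open>All \<open>T ^^ k - id\<close> map into the one space \<open>S\<close>, so their
    vanishing traces can be computed on the same basis \<open>B\<close>.\<close>
  have power_diff: "(T ^^ k) x - x \<in> S" for k x
  proof (induction k)
    case (Suc k)
    have "T ((T ^^ k) x) - (T ^^ k) x \<in> S" by (auto simp: S_def)
    from subspace_add[OF S this Suc] show ?case by simp
  qed (use S subspace_0 in auto)
  have diag: "(\<Sum>b\<in>B. (T ^^ k) b \<bullet> b) = card B" for k
  proof -
    have "lin_trace (\<lambda>x. (T ^^ k) x - x) = (\<Sum>b\<in>B. ((T ^^ k) b - b) \<bullet> b)"
      using power_diff B fin
      by (intro lin_trace_eq_sum_orthonormal linear_compose_sub linear_ident linear_funpow T) auto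
    moreover have "lin_trace (\<lambda>x. (T ^^ k) x - x) = 0"
      using trace[of k] by (simp add: lin_trace_def inner_diff_left sum_subtractf)
    moreover have "b \<bullet> b = 1" if "b \<in> B" for b
      using B(3)[OF that] by (simp add: norm_eq_1)
    ultimately show ?thesis by (simp add: inner_diff_left sum_subtractf)
  qed
  have "\<exists>y. \<forall>b\<in>B. b = T (y b) - y b"
    using B(1) by (intro bchoice) (auto simp: S_def)
  then obtain y where y: "\<And>b. b \<in> B \<Longrightarrow> b = T (y b) - y b" by blast
  have telescope: "(\<Sum>k<N. (T ^^ k) (T z - z)) = (T ^^ N) z - z" for N z
    by (induction N)
       (auto simp: linear_diff[OF linear_funpow[OF T]] funpow_swap1)
  \<comment> \<open>As \<open>b = T (y b) - y b\<close>, the sum of the \<open>(T ^^ k) b\<close>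
    telescopes to a vector of norm at most \<open>(C + 1) * norm (y b)\<close>. The bound does not
    depend on \<open>N\<close>, while the left side grows linearly unless \<open>B\<close> is
    empty.\<close>
  have "real N * card B \<le> (\<Sum>b\<in>B. (C + 1) * norm (y b))" for N
  proof -
    have "real N * card B = (\<Sum>k<N. \<Sum>b\<in>B. (T ^^ k) b \<bullet> b)" by (simp add: diag)
    also have "\<dots> = (\<Sum>b\<in>B. (\<Sum>k<N. (T ^^ k) b) \<bullet> b)"
      by (subst sum.swap) (simp add: inner_sum_left)
    also have "\<dots> \<le> (\<Sum>b\<in>B. (C + 1) * norm (y b))"
    proof (rule sum_mono)
      fix b assume b: "b \<in> B"
      have "(\<Sum>k<N. (T ^^ k) b) = (T ^^ N) (y b) - y b"
        using telescope[of "y b" N] y[OF b] by simp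
      then have "(\<Sum>k<N. (T ^^ k) b) \<bullet> b \<le> norm ((T ^^ N) (y b) - y b) * norm b"
        by (simp add: norm_cauchy_schwarz)
      also have "\<dots> \<le> norm ((T ^^ N) (y b)) + norm (y b)"
        using B(3)[OF b] by (simp add: norm_triangle_ineq4)
      also have "\<dots> \<le> (C + 1) * norm (y b)"
        using bounded[of N "y b"] by (simp add: algebra_simps)
      finally show "(\<Sum>k<N. (T ^^ k) b) \<bullet> b \<le> (C + 1) * norm (y b)" .
    qed
    finally show ?thesis .
  qed
  then have "card B = 0"
    by (metis mult.commute of_nat_0_less_iff not_gr_zero reals_Archimedean3 not_less)
  with fin B(5) have "S = {0}" by simp
  then show ?thesis unfolding S_def by (metis eq_iff_diff_eq_0 rangeI singletonD)
qed

section \<open>Derivatives in charts\<close>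

abbreviation chart_inv :: "('g, 'e) chart \<Rightarrow> 'e \<Rightarrow> 'g" where
  "chart_inv c \<equiv> inv_into (fst c) (snd c)"

lemma smooth_atlas_chartD:
  assumes "smooth_atlas A" "c \<in> A"
  shows "open (fst c)" "open (snd c ` fst c)" "continuous_on (fst c) (snd c)"
    "continuous_on (snd c ` fst c) (chart_inv c)" "inj_on (snd c) (fst c)"
    "p \<in> fst c \<Longrightarrow> chart_inv c (snd c p) = p"
proof -
  have *: "open (fst c) \<and> open (snd c ` fst c) \<and> homeomorphism (fst c) (snd c ` fst c) (snd c) (chart_inv c)"
    using assms by (cases c) (auto simp: smooth_atlas_def)
  then show "open (fst c)" "open (snd c ` fst c)" "continuous_on (fst c) (snd c)"
    "continuous_on (snd c ` fst c) (chart_inv c)" "inj_on (snd c) (fst c)"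
    "p \<in> fst c \<Longrightarrow> chart_inv c (snd c p) = p"
    by (auto simp: homeomorphism_def intro: inj_on_inverseI[of _ "chart_inv c"])
qed

lemma smooth_atlas_chart_at:
  assumes "smooth_atlas A"
  obtains c where "c \<in> A" "p \<in> fst c"
proof -
  have "p \<in> (\<Union>(U, f)\<in>A. U)" using assms by (simp add: smooth_atlas_def)
  then show ?thesis using that by fastforce
qed

lemma open_chart_preimage:
  assumes "smooth_atlas A" "c \<in> A" "open S"
  shows "open {x \<in> snd c ` fst c. chart_inv c x \<in> S}"
proof -
  have "open (snd c ` fst c \<inter> chart_inv c -` S)"
    using smooth_atlas_chartD[OF assms(1,2)] assms(3) by (intro continuous_open_preimage) auto
  then show ?thesis by (simp add: Int_def)
qed

lemma smooth_onD:
  assumes "smooth_on S f" "x \<in> S"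
  shows "f differentiable (at x)" "(f has_derivative frechet_derivative f (at x)) (at x)"
    "smooth_on S (\<lambda>x. frechet_derivative f (at x) v)"
proof -
  have "Ck_on (Suc k) S f" for k
    using assms(1) by (simp only: smooth_on_def)
  then show "f differentiable (at x)" "smooth_on S (\<lambda>x. frechet_derivative f (at x) v)"
    using assms(2) by (auto simp: smooth_on_def)
  then show "(f has_derivative frechet_derivative f (at x)) (at x)"
    by (simp flip: frechet_derivative_works)
qed

lemma smooth_on_cong:
  "open S \<Longrightarrow> (\<And>x. x \<in> S \<Longrightarrow> f x = g x) \<Longrightarrow> smooth_on S f \<Longrightarrow> smooth_on S g"
  using Ck_on_cong[of S f g] unfolding smooth_on_def by blast

text \<open>First-order differentiability is all that \<open>chart_deriv\<close> needs, and it
  passes to compositions by the ordinary chain rule; higher smoothness would need a chain rule for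
  \<open>Ck_on\<close>. Continuity is included so that an intermediate chart can be inserted on an
  open set.\<close>

definition chart_differentiable ::
    "('g::topological_space, 'e::euclidean_space) chart set \<Rightarrow> ('g \<Rightarrow> 'g) \<Rightarrow> bool" where
  "chart_differentiable A F \<longleftrightarrow> continuous_on UNIV F \<and>
     (\<forall>c\<in>A. \<forall>d\<in>A. \<forall>p\<in>fst c. F p \<in> fst d \<longrightarrow>
       (snd d \<circ> F \<circ> chart_inv c) differentiable (at (snd c p)))"

lemma smooth_map_chart_differentiable:
  assumes "smooth_map A A F"
  shows "chart_differentiable A F"
  unfolding chart_differentiable_def
proof (intro conjI ballI impI)
  show "continuous_on UNIV F" using assms by (simp add: smooth_map_def)
  fix c d p assume "c \<in> A" "d \<in> A" "p \<in> fst c" "F p \<in> fst d"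
  moreover from this have "smooth_on (snd c ` (fst c \<inter> F -` fst d)) (snd d \<circ> F \<circ> chart_inv c)"
    using assms unfolding smooth_map_def by (cases c; cases d) fastforce
  ultimately show "(snd d \<circ> F \<circ> chart_inv c) differentiable (at (snd c p))"
    by (intro smooth_onD(1)) auto
qed

lemma smooth_map_id: "smooth_atlas A \<Longrightarrow> smooth_map A A id"
  by (auto simp: smooth_map_def smooth_atlas_def continuous_on_id)

lemma chart_deriv_has_derivative:
  assumes "chart_differentiable A F" "c \<in> A" "d \<in> A" "p \<in> fst c" "F p \<in> fst d"
  shows "((snd d \<circ> F \<circ> chart_inv c) has_derivative chart_deriv c d F p) (at (snd c p))"
  using assms by (auto simp: chart_differentiable_def chart_deriv_def simp flip: frechet_derivative_works)

lemma linear_chart_deriv: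
  assumes "chart_differentiable A F" "c \<in> A" "d \<in> A" "p \<in> fst c" "F p \<in> fst d"
  shows "linear (chart_deriv c d F p)"
  using chart_deriv_has_derivative[OF assms] by (rule has_derivative_linear)

lemma chart_deriv_eqI:
  "((snd d \<circ> F \<circ> chart_inv c) has_derivative D) (at (snd c p)) \<Longrightarrow> chart_deriv c d F p = D"
  unfolding chart_deriv_def by (rule frechet_derivative_at[symmetric])

text \<open>Inserting the chart \<open>d\<close> between \<open>F\<close> and \<open>G\<close>
  changes nothing at points that \<open>F\<close> sends into its domain; by continuity these form a
  neighbourhood, which is enough for the derivative.\<close>

lemma chart_composition_has_derivative:
  assumes "smooth_atlas A" "c \<in> A" "d \<in> A" "e \<in> A" "p \<in> fst c" "F p \<in> fst d" "G (F p) \<in> fst e"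
    and F: "chart_differentiable A F" and G: "chart_differentiable A G"
  shows "((snd e \<circ> (G \<circ> F) \<circ> chart_inv c) has_derivative
    chart_deriv d e G (F p) \<circ> chart_deriv c d F p) (at (snd c p))"
proof -
  let ?f = "snd d \<circ> F \<circ> chart_inv c" and ?g = "snd e \<circ> G \<circ> chart_inv d"
  note c = smooth_atlas_chartD[OF assms(1,2)] and d = smooth_atlas_chartD[OF assms(1,3)]
  let ?S = "{x \<in> snd c ` fst c. chart_inv c x \<in> F -` fst d}"
  have "continuous_on UNIV F" using F by (simp add: chart_differentiable_def)
  then have "open (F -` fst d)" using d(1) by (simp add: open_vimage)
  then have S: "open ?S" by (rule open_chart_preimage[OF assms(1,2)])
  have "(?f has_derivative chart_deriv c d F p) (at (snd c p))"
    using assms by (intro chart_deriv_has_derivative)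
  moreover have "(?g has_derivative chart_deriv d e G (F p)) (at (?f (snd c p)))"
    using assms chart_deriv_has_derivative[OF G assms(3,4)] by (simp add: c(6))
  ultimately have "(?g \<circ> ?f has_derivative chart_deriv d e G (F p) \<circ> chart_deriv c d F p) (at (snd c p))"
    by (rule diff_chain_at)
  then show ?thesis
  proof (rule has_derivative_transform_within_open[OF _ S])
    show "snd c p \<in> ?S" using assms c(6) by auto
    show "(?g \<circ> ?f) x = (snd e \<circ> (G \<circ> F) \<circ> chart_inv c) x" if "x \<in> ?S" for x
      using that d(6) by auto
  qed
qed

lemma chart_differentiable_compose:
  assumes "smooth_atlas A" "chart_differentiable A F" "chart_differentiable A G"
  shows "chart_differentiable A (G \<circ> F)"
  unfolding chart_differentiable_def
proof (intro conjI ballI impI)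
  show "continuous_on UNIV (G \<circ> F)"
    using assms unfolding chart_differentiable_def
    by (metis continuous_on_compose continuous_on_subset subset_UNIV)
  fix c e p assume *: "c \<in> A" "e \<in> A" "p \<in> fst c" "(G \<circ> F) p \<in> fst e"
  obtain d where "d \<in> A" "F p \<in> fst d" using smooth_atlas_chart_at[OF assms(1)] .
  with * show "(snd e \<circ> (G \<circ> F) \<circ> chart_inv c) differentiable at (snd c p)"
    using chart_composition_has_derivative[OF assms(1) _ _ _ _ _ _ assms(2,3)]
    by (intro differentiableI) simp
qed

lemma chart_deriv_compose:
  assumes "smooth_atlas A" "c \<in> A" "d \<in> A" "e \<in> A" "p \<in> fst c" "F p \<in> fst d" "G (F p) \<in> fst e"
    and "chart_differentiable A F" "chart_differentiable A G"
  shows "chart_deriv c e (G \<circ> F) p = chart_deriv d e G (F p) \<circ> chart_deriv c d F p"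
  using chart_composition_has_derivative[OF assms] by (rule chart_deriv_eqI)

lemma chart_deriv_id:
  assumes "smooth_atlas A" "c \<in> A" "p \<in> fst c"
  shows "chart_deriv c c id p = id"
proof (rule chart_deriv_eqI)
  note c = smooth_atlas_chartD[OF assms(1,2)]
  have "(id has_derivative id) (at (snd c p))" by (simp add: id_def)
  then show "((snd c \<circ> id \<circ> chart_inv c) has_derivative id) (at (snd c p))"
    by (rule has_derivative_transform_within_open[OF _ c(2)])
      (use assms(3) c(6) in \<open>auto simp: f_inv_into_f\<close>)
qed

section \<open>Multiplication in coordinates, translations and conjugation\<close>

context lie_group
begin

definition mult_coords :: "('g, 'e) chart \<Rightarrow> ('g, 'e) chart \<Rightarrow> ('g, 'e) chart \<Rightarrow> 'e \<times> 'e \<Rightarrow> 'e" where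
  "mult_coords c d k = (\<lambda>(x, y). snd k (chart_inv c x \<odot> chart_inv d y))"

definition mult_dom :: "('g, 'e) chart \<Rightarrow> ('g, 'e) chart \<Rightarrow> ('g, 'e) chart \<Rightarrow> ('e \<times> 'e) set" where
  "mult_dom c d k = {(x, y). x \<in> snd c ` fst c \<and> y \<in> snd d ` fst d \<and>
     chart_inv c x \<odot> chart_inv d y \<in> fst k}"

lemma continuous_mult: "continuous_on UNIV (\<lambda>(x, y). x \<odot> y)"
  using smooth_mult by (simp add: smooth_map_def)

lemma continuous_on_mult [continuous_intros]:
  fixes f g :: "'a::topological_space \<Rightarrow> 'g"
  assumes "continuous_on S f" "continuous_on S g"
  shows "continuous_on S (\<lambda>x. f x \<odot> g x)"
  using continuous_on_compose2[OF continuous_mult continuous_on_Pair[OF assms]] by simp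

lemma open_mult_dom:
  assumes "c \<in> A" "d \<in> A" "k \<in> A"
  shows "open (mult_dom c d k)"
proof -
  note c = smooth_atlas_chartD[OF smooth_atlas]
  have "continuous_on (snd c ` fst c \<times> snd d ` fst d) (\<lambda>z. chart_inv c (fst z) \<odot> chart_inv d (snd z))"
    using c(4)[OF assms(1)] c(4)[OF assms(2)]
    by (intro continuous_intros continuous_on_compose2[where g = "chart_inv c" and f = fst]
        continuous_on_compose2[where g = "chart_inv d" and f = snd]) auto
  moreover have "open (snd c ` fst c \<times> snd d ` fst d)"
    using c(2) assms by (intro open_Times) auto
  ultimately have "open ((snd c ` fst c \<times> snd d ` fst d) \<inter>
      (\<lambda>z. chart_inv c (fst z) \<odot> chart_inv d (snd z)) -` fst k)"
    using c(1)[OF assms(3)] by (intro continuous_open_preimage)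
  also have "\<dots> = mult_dom c d k" by (auto simp: mult_dom_def)
  finally show ?thesis .
qed

lemma mem_mult_dom:
  assumes "c \<in> A" "d \<in> A" "p \<in> fst c" "q \<in> fst d" "p \<odot> q \<in> fst k"
  shows "(snd c p, snd d q) \<in> mult_dom c d k"
  using assms smooth_atlas_chartD(6)[OF smooth_atlas] by (auto simp: mult_dom_def)

text \<open>Unpacks smoothness for the product atlas: product charts are injective, so on the
  relevant domain their inverse is the pair of chart inverses.\<close>

lemma smooth_on_mult_coords:
  assumes "c \<in> A" "d \<in> A" "k \<in> A"
  shows "smooth_on (mult_dom c d k) (mult_coords c d k)"
proof -
  note inv = smooth_atlas_chartD(6)[OF smooth_atlas]
  let ?m = "\<lambda>(x, y). x \<odot> y" and ?cd = "map_prod (snd c) (snd d)"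
  have "(fst c \<times> fst d, ?cd) \<in> prod_atlas A A"
    using assms by (force simp: prod_atlas_def)
  then have sm: "smooth_on (?cd ` ((fst c \<times> fst d) \<inter> ?m -` fst k)) (snd k \<circ> ?m \<circ> inv_into (fst c \<times> fst d) ?cd)"
    using smooth_mult assms(3) unfolding smooth_map_def by (cases k) fastforce
  have inj: "inj_on ?cd (fst c \<times> fst d)"
    using smooth_atlas_chartD(5)[OF smooth_atlas] assms by (auto simp: inj_on_def)
  have dom: "?cd ` ((fst c \<times> fst d) \<inter> ?m -` fst k) = mult_dom c d k"
    using inv[OF assms(1)] inv[OF assms(2)] by (force simp: mult_dom_def)
  have "inv_into (fst c \<times> fst d) ?cd (x, y) = (chart_inv c x, chart_inv d y)"
    if "(x, y) \<in> mult_dom c d k" for x y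
    using that by (intro inv_into_f_eq[OF inj]) (auto simp: mult_dom_def f_inv_into_f inv_into_into)
  then show ?thesis
    using sm open_mult_dom[OF assms] unfolding dom
    by (elim smooth_on_cong[rotated 2]) (auto simp: mult_coords_def)
qed

lemma mult_coords_has_derivative:
  assumes "c \<in> A" "d \<in> A" "k \<in> A" "p \<in> fst c" "q \<in> fst d" "p \<odot> q \<in> fst k"
  shows "(mult_coords c d k has_derivative frechet_derivative (mult_coords c d k) (at (snd c p, snd d q)))
    (at (snd c p, snd d q))"
  using smooth_onD(2)[OF smooth_on_mult_coords[OF assms(1-3)] mem_mult_dom[OF assms(1,2,4-6)]] .

lemma left_mult_has_derivative:
  assumes "c \<in> A" "d \<in> A" "k \<in> A" "p \<in> fst c" "q \<in> fst d" "p \<odot> q \<in> fst k"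
  shows "((snd k \<circ> (\<odot>) p \<circ> chart_inv d) has_derivative
    (\<lambda>v. frechet_derivative (mult_coords c d k) (at (snd c p, snd d q)) (0, v))) (at (snd d q))"
proof -
  have "((\<lambda>y. (snd c p, y)) has_derivative (\<lambda>v. (0, v))) (at (snd d q))"
    by (auto intro!: derivative_eq_intros)
  from has_derivative_compose[OF this mult_coords_has_derivative[OF assms]]
  show ?thesis
    using smooth_atlas_chartD(6)[OF smooth_atlas assms(1,4)] by (simp add: mult_coords_def comp_def)
qed

lemma right_mult_has_derivative:
  assumes "c \<in> A" "d \<in> A" "k \<in> A" "p \<in> fst c" "q \<in> fst d" "p \<odot> q \<in> fst k"
  shows "((snd k \<circ> (\<lambda>x. x \<odot> q) \<circ> chart_inv c) has_derivative
    (\<lambda>v. frechet_derivative (mult_coords c d k) (at (snd c p, snd d q)) (v, 0))) (at (snd c p))"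
proof -
  have "((\<lambda>x. (x, snd d q)) has_derivative (\<lambda>v. (v, 0))) (at (snd c p))"
    by (auto intro!: derivative_eq_intros)
  from has_derivative_compose[OF this mult_coords_has_derivative[OF assms]]
  show ?thesis
    using smooth_atlas_chartD(6)[OF smooth_atlas assms(2,5)] by (simp add: mult_coords_def comp_def)
qed

lemma chart_differentiable_left_mult: "chart_differentiable A ((\<odot>) p)"
  unfolding chart_differentiable_def
proof (intro conjI ballI impI)
  show "continuous_on UNIV ((\<odot>) p)" by (intro continuous_intros)
  fix d k q assume "d \<in> A" "k \<in> A" "q \<in> fst d" "p \<odot> q \<in> fst k"
  then show "(snd k \<circ> (\<odot>) p \<circ> chart_inv d) differentiable (at (snd d q))"
    using smooth_atlas_chart_at[OF smooth_atlas, of p] left_mult_has_derivative differentiableI by metis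
qed

lemma chart_differentiable_right_mult: "chart_differentiable A (\<lambda>x. x \<odot> q)"
  unfolding chart_differentiable_def
proof (intro conjI ballI impI)
  show "continuous_on UNIV (\<lambda>x. x \<odot> q)" by (intro continuous_intros)
  fix c k p assume "c \<in> A" "k \<in> A" "p \<in> fst c" "p \<odot> q \<in> fst k"
  then show "(snd k \<circ> (\<lambda>x. x \<odot> q) \<circ> chart_inv c) differentiable (at (snd c p))"
    using smooth_atlas_chart_at[OF smooth_atlas, of q] right_mult_has_derivative differentiableI by metis
qed

lemmas chart_deriv_left_mult = chart_deriv_eqI[OF left_mult_has_derivative]
lemmas chart_deriv_right_mult = chart_deriv_eqI[OF right_mult_has_derivative]

text \<open>Written as a composition of two translations so that the chain rule applies
  directly.\<close>

definition conj_by :: "'g \<Rightarrow> 'g \<Rightarrow> 'g" where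
  "conj_by g = (\<lambda>x. x \<odot> ginv g) \<circ> (\<odot>) g"

lemma conj_by_unit: "conj_by g gunit = gunit"
  by (simp add: conj_by_def)

lemma conj_by_mult: "conj_by (g \<odot> h) = conj_by g \<circ> conj_by h"
  by (simp add: conj_by_def fun_eq_iff assoc inverse_distrib_swap)

lemma chart_differentiable_conj_by: "chart_differentiable A (conj_by g)"
  unfolding conj_by_def
  by (intro chart_differentiable_compose smooth_atlas chart_differentiable_left_mult
      chart_differentiable_right_mult)

end

section \<open>The adjoint representation\<close>

text \<open>A fixed chart at the unit identifies the tangent space there with the Euclidean space
  \<open>'e\<close>. The adjoint representation thereby acts by endomorphisms of \<open>'e\<close>,
  whose powers and traces make sense.\<close>

locale lie_group_chart = lie_group gmult gunit ginv A
  for gmult :: "'g \<Rightarrow> 'g \<Rightarrow> 'g::{second_countable_topology, t2_space}" (infixl "\<odot>" 70)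
    and gunit :: 'g
    and ginv :: "'g \<Rightarrow> 'g"
    and A :: "('g, 'e::euclidean_space) chart set" +
  fixes c0 :: "('g, 'e) chart"
  assumes c0: "c0 \<in> A" "gunit \<in> fst c0"
begin

definition Ad :: "'g \<Rightarrow> 'e \<Rightarrow> 'e" where
  "Ad g = chart_deriv c0 c0 (conj_by g) gunit"

lemma linear_Ad: "linear (Ad g)"
  unfolding Ad_def using c0 by (intro linear_chart_deriv[OF chart_differentiable_conj_by]) (auto simp: conj_by_unit)

lemma chart_deriv_compose_unit:
  assumes "chart_differentiable A F" "chart_differentiable A G" "F gunit = gunit" "G gunit = gunit"
  shows "chart_deriv c0 c0 (G \<circ> F) gunit = chart_deriv c0 c0 G gunit \<circ> chart_deriv c0 c0 F gunit"
  using chart_deriv_compose[OF smooth_atlas c0(1) c0(1) c0(1) c0(2), of F G] assms c0 by simp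

lemma Ad_mult: "Ad (g \<odot> h) = Ad g \<circ> Ad h"
  unfolding Ad_def conj_by_mult
  by (intro chart_deriv_compose_unit chart_differentiable_conj_by conj_by_unit)

lemma Ad_unit: "Ad gunit = id"
proof -
  have "conj_by gunit = id"
    using inverse_unique[of gunit gunit] by (auto simp: conj_by_def fun_eq_iff)
  then show ?thesis
    unfolding Ad_def using chart_deriv_id[OF smooth_atlas c0] by simp
qed

text \<open>Turns a uniform bound on all \<open>Ad g\<close> into a bound on the powers of a single
  one.\<close>

lemma Ad_funpow: "\<exists>h. Ad g ^^ k = Ad h"
proof (induction k)
  case 0
  show ?case by (rule exI[of _ gunit]) (simp add: Ad_unit id_def)
next
  case (Suc k)
  then show ?case using Ad_mult by (metis funpow.simps(2))
qed

text \<open>Differentiate \<open>F \<circ> conj_by g \<circ> inv F = conj_by (F g)\<close> at the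
  unit, which all the maps involved fix.\<close>

lemma Ad_automorphism:
  assumes F: "lie_group_automorphism (\<odot>) A F"
  defines "D \<equiv> chart_deriv c0 c0 F gunit" and "D' \<equiv> chart_deriv c0 c0 (inv F) gunit"
  shows "linear D" "linear D'" "D' \<circ> D = id" "Ad (F g) = D \<circ> Ad g \<circ> D'"
proof -
  have bij: "bij F" and hom: "F (x \<odot> y) = F x \<odot> F y" for x y
    using F by (auto simp: lie_group_automorphism_def)
  have diff: "chart_differentiable A F" "chart_differentiable A (inv F)"
    using F by (auto simp: lie_group_automorphism_def intro: smooth_map_chart_differentiable)
  have unit: "F gunit = gunit"
    by (metis hom left_neutral left_cancel right_neutral)
  then have unit': "inv F gunit = gunit" using bij by (metis bij_inv_eq_iff)
  have inv_hom: "F (ginv g) = ginv (F g)" for g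
    by (metis hom inverse_unique right_inverse unit)
  show "linear D" "linear D'" unfolding D_def D'_def
    using c0 diff by (auto intro!: linear_chart_deriv simp: unit unit')
  have "inv F \<circ> F = id" using bij by (simp add: bij_is_inj)
  then show "D' \<circ> D = id"
    unfolding D_def D'_def
    using chart_deriv_compose_unit[OF diff unit unit'] chart_deriv_id[OF smooth_atlas c0] by simp
  have "F \<circ> conj_by g \<circ> inv F = conj_by (F g)"
    using bij by (auto simp: fun_eq_iff conj_by_def hom inv_hom bij_is_surj surj_f_inv_f)
  then have "Ad (F g) = chart_deriv c0 c0 (F \<circ> conj_by g \<circ> inv F) gunit" by (simp add: Ad_def)
  also have "\<dots> = D \<circ> Ad g \<circ> D'"
    unfolding D_def D'_def Ad_def
    using diff unit unit' conj_by_unit chart_differentiable_conj_by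
    by (simp add: chart_deriv_compose_unit chart_differentiable_compose[OF smooth_atlas])
  finally show "Ad (F g) = D \<circ> Ad g \<circ> D'" .
qed

section \<open>Traces of powers in the adjoint representation\<close>

definition Ad_trace :: "nat \<Rightarrow> 'g \<Rightarrow> real" where
  "Ad_trace k g = lin_trace (Ad g ^^ k)"

lemma Ad_trace_automorphism:
  assumes "lie_group_automorphism (\<odot>) A F"
  shows "Ad_trace k (F g) = Ad_trace k g"
proof -
  define D D' where D_def: "D = chart_deriv c0 c0 F gunit" and D'_def: "D' = chart_deriv c0 c0 (inv F) gunit"
  note Ad_F = Ad_automorphism[OF assms, folded D_def D'_def]
  have D'D: "D' (D x) = x" for x using Ad_F(3) by (metis comp_apply id_apply)
  have inj: "inj D" using D'D by (rule inj_on_inverseI)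
  \<comment> \<open>The chain rule supplied only a left inverse of \<open>D\<close>; finite
    dimension makes it two-sided, as the conjugation formula for the powers already needs at
    \<open>k = 0\<close>.\<close>
  then have "surj D" using Ad_F(1) linear_injective_imp_surjective by blast
  then have DD': "D (D' x) = x" for x using D'D by (metis surjD)
  have "(Ad (F g) ^^ k) x = D ((Ad g ^^ k) (D' x))" for x
    by (induction k) (auto simp: Ad_F(4) D'D DD')
  then have "Ad_trace k (F g) = lin_trace (\<lambda>x. D ((Ad g ^^ k) (D' x)))"
    by (simp add: Ad_trace_def lin_trace_def)
  also have "\<dots> = lin_trace (\<lambda>x. (Ad g ^^ k) (D' (D x)))"
  proof (rule lin_trace_comp_commute[OF Ad_F(1)])
    show "linear (\<lambda>x. (Ad g ^^ k) (D' x))"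
      using linear_compose[OF Ad_F(2) linear_funpow[OF linear_Ad]] by (simp add: comp_def)
  qed
  also have "\<dots> = Ad_trace k g" by (simp add: Ad_trace_def D'D)
  finally show ?thesis .
qed

lemma continuous_ginv: "continuous_on UNIV ginv"
  using smooth_inverse by (simp add: smooth_map_def)

text \<open>\<open>Ad g\<close> is the derivative of left translation by \<open>g\<close> at the
  unit followed by that of right translation by \<open>ginv g\<close> at \<open>g\<close>. With
  \<open>g\<close> and \<open>ginv g\<close> both in \<open>c0\<close>, these are partial
  derivatives of the single function \<open>mult_coords c0 c0 c0\<close>.\<close>

lemma continuous_on_Ad_near_unit:
  "continuous_on {g \<in> fst c0. ginv g \<in> fst c0} (\<lambda>g. Ad g w)"
proof -
  let ?N = "{g \<in> fst c0. ginv g \<in> fst c0}" and ?\<mu> = "mult_coords c0 c0 c0"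
  define L where "L = (\<lambda>g. frechet_derivative ?\<mu> (at (snd c0 g, snd c0 gunit)) (0, w))"
  define R where "R = (\<lambda>g u. frechet_derivative ?\<mu> (at (snd c0 g, snd c0 (ginv g))) (u, 0))"
  have cont: "continuous_on (mult_dom c0 c0 c0) (\<lambda>z. frechet_derivative ?\<mu> (at z) v)" for v
  proof -
    have "Ck_on (Suc 0) (mult_dom c0 c0 c0) ?\<mu>"
      using smooth_on_mult_coords[OF c0(1) c0(1) c0(1)] by (simp only: smooth_on_def)
    then show ?thesis unfolding Ck_on.simps by blast
  qed
  have coord: "continuous_on ?N (snd c0)" "continuous_on ?N (\<lambda>g. snd c0 (ginv g))"
    using continuous_on_subset[OF smooth_atlas_chartD(3)[OF smooth_atlas c0(1)], of ?N]
      continuous_on_compose2[OF smooth_atlas_chartD(3)[OF smooth_atlas c0(1)]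
        continuous_on_subset[OF continuous_ginv subset_UNIV], of ?N]
    by auto
  have "continuous_on ?N L" unfolding L_def
    using c0 coord by (intro continuous_on_compose2[OF cont] continuous_on_Pair continuous_on_const) (auto intro!: mem_mult_dom)
  moreover have "continuous_on ?N (\<lambda>g. R g u)" for u unfolding R_def
    using c0 coord by (intro continuous_on_compose2[OF cont] continuous_on_Pair continuous_on_const) (auto intro!: mem_mult_dom)
  \<comment> \<open>Continuity of \<open>R g u\<close> is known only for fixed \<open>u\<close>,
    while the vector \<open>L g\<close> moves with \<open>g\<close>; expanding \<open>L g\<close> in
    \<open>Basis\<close> separates the two.\<close>
  ultimately have "continuous_on ?N (\<lambda>g. \<Sum>b\<in>Basis. (L g \<bullet> b) *\<^sub>R R g b)"
    by (intro continuous_intros) auto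
  moreover have "(\<Sum>b\<in>Basis. (L g \<bullet> b) *\<^sub>R R g b) = Ad g w" if g: "g \<in> ?N" for g
  proof -
    have R: "chart_deriv c0 c0 (\<lambda>x. x \<odot> ginv g) g = R g"
      unfolding R_def using g c0 by (intro chart_deriv_right_mult) auto
    have "linear (chart_deriv c0 c0 (\<lambda>x. x \<odot> ginv g) g)"
      using g c0 by (intro linear_chart_deriv[OF chart_differentiable_right_mult]) auto
    then have lin: "linear (R g)" by (simp only: R)
    have "Ad g = chart_deriv c0 c0 (\<lambda>x. x \<odot> ginv g) (g \<odot> gunit) \<circ> chart_deriv c0 c0 ((\<odot>) g) gunit"
      unfolding Ad_def conj_by_def using g c0
      by (intro chart_deriv_compose[OF smooth_atlas c0(1) c0(1) c0(1) c0(2)] chart_differentiable_left_mult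
          chart_differentiable_right_mult) auto
    also have "chart_deriv c0 c0 ((\<odot>) g) gunit = (\<lambda>v. frechet_derivative ?\<mu> (at (snd c0 g, snd c0 gunit)) (0, v))"
      using g c0 by (intro chart_deriv_left_mult) auto
    finally have "Ad g w = R g (L g)" by (simp add: R L_def)
    also have "\<dots> = (\<Sum>b\<in>Basis. (L g \<bullet> b) *\<^sub>R R g b)" by (rule linear_eq_sum_Basis[OF lin])
    finally show ?thesis by (rule sym)
  qed
  ultimately show ?thesis by (rule continuous_on_eq)
qed

text \<open>A homomorphism that is continuous near the unit is continuous everywhere: near
  \<open>h\<close>, write \<open>g = h \<odot> (ginv h \<odot> g)\<close> and pull out the fixed
  linear map \<open>Ad h\<close>.\<close>

lemma continuous_on_Ad: "continuous_on UNIV (\<lambda>g. Ad g w)"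
proof -
  let ?N = "{g \<in> fst c0. ginv g \<in> fst c0}"
  have "open (fst c0 \<inter> ginv -` fst c0)"
    using smooth_atlas_chartD(1)[OF smooth_atlas c0(1)] continuous_ginv
    by (intro open_Int open_vimage)
  then have N: "open ?N" by (simp add: Int_def)
  have unitN: "gunit \<in> ?N" using c0 inverse_unique[of gunit gunit] by simp
  have "isCont (\<lambda>g. Ad g w) h" for h
  proof -
    let ?M = "(\<odot>) (ginv h) -` ?N"
    have M: "open ?M" by (intro open_vimage N continuous_intros)
    have hM: "h \<in> ?M" using unitN by simp
    have "continuous_on ?M (\<lambda>g. Ad (ginv h \<odot> g) w)"
      by (rule continuous_on_compose2[OF continuous_on_Ad_near_unit]) (auto intro!: continuous_intros)
    then have "continuous_on ?M (\<lambda>g. Ad h (Ad (ginv h \<odot> g) w))"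
      using linear_Ad linear_conv_bounded_linear bounded_linear.continuous_on by blast
    moreover have "Ad h (Ad (ginv h \<odot> g) w) = Ad g w" for g
    proof -
      have "h \<odot> (ginv h \<odot> g) = g" by (simp flip: assoc)
      then show ?thesis using fun_cong[OF Ad_mult[of h "ginv h \<odot> g"], of w] by simp
    qed
    ultimately show ?thesis using M hM by (simp add: continuous_on_eq_continuous_at)
  qed
  then show ?thesis by (simp add: continuous_at_imp_continuous_on)
qed

lemma continuous_on_Ad_trace: "continuous_on UNIV (Ad_trace k)"
proof -
  have "continuous_on UNIV (\<lambda>g. (Ad g ^^ k) w)" for w
  proof (induction k)
    case (Suc k)
    have "(Ad g ^^ Suc k) w = (\<Sum>b\<in>Basis. ((Ad g ^^ k) w \<bullet> b) *\<^sub>R Ad g b)" for g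
      unfolding funpow.simps comp_apply by (rule linear_eq_sum_Basis[OF linear_Ad])
    moreover have "continuous_on UNIV (\<lambda>g. \<Sum>b\<in>Basis. ((Ad g ^^ k) w \<bullet> b) *\<^sub>R Ad g b)"
      by (intro continuous_intros Suc continuous_on_Ad)
    ultimately show ?case by presburger
  qed simp
  then show ?thesis unfolding Ad_trace_def[abs_def] lin_trace_def
    by (intro continuous_on_sum continuous_on_inner continuous_on_const)
qed

lemma Ad_trace_unit: "Ad_trace k gunit = DIM('e)"
  unfolding Ad_trace_def Ad_unit by (simp add: lin_trace_def)

lemma Ad_bounded:
  assumes "compact (UNIV :: 'g set)"
  obtains C where "\<And>g w. norm (Ad g w) \<le> C * norm w"
proof -
  have "\<exists>C. \<forall>g. norm (Ad g b) \<le> C" for b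
    using compact_imp_bounded[OF compact_continuous_image[OF continuous_on_Ad assms, of b]]
    by (auto simp: bounded_iff)
  then obtain C where C: "norm (Ad g b) \<le> C b" for g b by metis
  have "norm (Ad g w) \<le> (\<Sum>b\<in>Basis. C b) * norm w" for g w
  proof -
    have "norm (Ad g w) \<le> (\<Sum>b\<in>Basis. norm ((w \<bullet> b) *\<^sub>R Ad g b))"
      by (subst linear_eq_sum_Basis[OF linear_Ad]) (rule norm_sum)
    also have "\<dots> \<le> (\<Sum>b\<in>Basis. norm w * C b)"
      using C Basis_le_norm by (intro sum_mono) (auto intro!: mult_mono)
    also have "\<dots> = (\<Sum>b\<in>Basis. C b) * norm w"
      by (simp add: sum_distrib_left mult.commute)
    finally show ?thesis .
  qed
  then show ?thesis by (rule that)
qed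

lemma Ad_eq_id_if_trace:
  assumes "compact (UNIV :: 'g set)" "\<And>k. Ad_trace k g = DIM('e)"
  shows "Ad g = id"
proof -
  obtain C where C: "\<And>g w. norm (Ad g w) \<le> C * norm w" using Ad_bounded[OF assms(1)] by metis
  have "Ad g x = x" for x
  proof (rule eq_id_if_power_bounded_if_trace_maximal[OF linear_Ad])
    show "norm ((Ad g ^^ k) x) \<le> C * norm x" for k x
    proof -
      obtain h where "Ad g ^^ k = Ad h" using Ad_funpow by blast
      then show ?thesis using C by simp
    qed
    show "lin_trace (Ad g ^^ k) = DIM('e)" for k using assms(2) by (simp add: Ad_trace_def)
  qed
  then show ?thesis by auto
qed

end

section \<open>Left-invariant fields and the centre\<close>

context lie_group_chart
begin

text \<open>Identifies the tangent space at the unit with the Lie algebra of left-invariant fields;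
  the default 0 is the normalisation demanded by \<open>smooth_vector_field\<close>.\<close>

definition left_field :: "'e \<Rightarrow> ('g, 'e) vfield" where
  "left_field v = (\<lambda>c p. if c \<in> A \<and> p \<in> fst c then chart_deriv c0 c ((\<odot>) p) gunit v else 0)"

lemma left_field_chart_deriv:
  "c \<in> A \<Longrightarrow> p \<in> fst c \<Longrightarrow> left_field v c p = chart_deriv c0 c ((\<odot>) p) gunit v"
  by (simp add: left_field_def)

text \<open>Since \<open>p \<odot> gunit = p\<close>, one chart \<open>c\<close> serves for both the
  left factor and the product. The field becomes a partial derivative of one smooth function, and
  its own derivatives become mixed second derivatives.\<close>

lemma left_field_mult_coords:
  assumes "c \<in> A" "p \<in> fst c"
  shows "left_field v c p =
    frechet_derivative (mult_coords c c0 c) (at (snd c p, snd c0 gunit)) (0, v)"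
  using chart_deriv_left_mult[OF assms(1) c0(1) assms(1,2) c0(2)] assms
  by (simp add: left_field_chart_deriv)

lemma linear_left_mult_unit: "c \<in> A \<Longrightarrow> p \<in> fst c \<Longrightarrow> linear (chart_deriv c0 c ((\<odot>) p) gunit)"
  using c0 by (intro linear_chart_deriv[OF chart_differentiable_left_mult]) auto

lemma linear_left_field: "linear left_field"
proof
  show "left_field (x + y) = left_field x + left_field y" for x y
    using linear_add[OF linear_left_mult_unit] by (auto simp: left_field_def fun_eq_iff)
  show "left_field (r *\<^sub>R x) = r *\<^sub>R left_field x" for r x
    using linear_cmul[OF linear_left_mult_unit] by (auto simp: left_field_def fun_eq_iff scaleR_fun_def)
qed

lemma left_field_coords_smooth:
  assumes "c \<in> A"
  shows "smooth_on (snd c ` fst c) (left_field v c \<circ> chart_inv c)"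
proof -
  let ?S = "mult_dom c c0 c" and ?a = "snd c0 gunit"
  note c = smooth_atlas_chartD[OF smooth_atlas assms]
  let ?P = "\<lambda>z. frechet_derivative (mult_coords c c0 c) (at z) (0, v)"
  have dom: "(x, ?a) \<in> ?S" if "x \<in> snd c ` fst c" for x
    using that assms c0 by (auto intro!: mem_mult_dom)
  \<comment> \<open>\<open>smooth_onD\<close> needs a point of the set, so the empty domain is
    treated separately.\<close>
  have "smooth_on ?S ?P" if "?S \<noteq> {}"
    using that smooth_onD(3)[OF smooth_on_mult_coords] assms c0 by blast
  moreover have "smooth_on {} f" for f :: "'e \<times> 'e \<Rightarrow> 'e"
  proof -
    have "Ck_on k {} f" for k and f :: "'e \<times> 'e \<Rightarrow> 'e" by (induction k arbitrary: f) auto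
    then show ?thesis by (simp add: smooth_on_def)
  qed
  ultimately have "smooth_on ?S ?P" by metis
  then have "smooth_on (snd c ` fst c) (\<lambda>x. ?P (x, ?a))"
    using Ck_on_slice[OF _ c(2) dom] unfolding smooth_on_def by blast
  then show ?thesis
  proof (rule smooth_on_cong[OF c(2), rotated])
    fix x assume "x \<in> snd c ` fst c"
    then show "?P (x, ?a) = (left_field v c \<circ> chart_inv c) x"
      using left_field_mult_coords[OF assms] c(6) by auto
  qed
qed

lemma left_field_smooth: "smooth_vector_field A (left_field v)"
  unfolding smooth_vector_field_def
proof (intro conjI ballI allI impI)
  show "left_field v c p = 0" if "\<not> (c \<in> A \<and> p \<in> fst c)" for c p
    using that by (auto simp: left_field_def)
  show "case c of (U, f) \<Rightarrow> smooth_on (f ` U) (left_field v (U, f) \<circ> inv_into U f)" if "c \<in> A" for c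
    using left_field_coords_smooth[OF that] by (simp add: case_prod_beta)
  fix c d p assume *: "c \<in> A" "d \<in> A" "p \<in> fst c \<inter> fst d"
  have "chart_deriv c0 d (id \<circ> (\<odot>) p) gunit = chart_deriv c d id (p \<odot> gunit) \<circ> chart_deriv c0 c ((\<odot>) p) gunit"
    using * c0 by (intro chart_deriv_compose[OF smooth_atlas] chart_differentiable_left_mult
        smooth_map_chart_differentiable smooth_map_id smooth_atlas) auto
  then show "left_field v d p = chart_deriv c d id p (left_field v c p)"
    using * by (simp add: left_field_chart_deriv)
qed

lemma left_field_left_invariant: "left_field v \<in> left_invariant_fields (\<odot>) A"
  unfolding left_invariant_fields_def
proof (intro CollectI conjI allI ballI impI left_field_smooth)
  fix g p c d assume *: "c \<in> A" "d \<in> A" "p \<in> fst c \<and> g \<odot> p \<in> fst d"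
  have "(\<odot>) (g \<odot> p) = (\<odot>) g \<circ> (\<odot>) p" by (simp add: fun_eq_iff assoc)
  moreover have "chart_deriv c0 d ((\<odot>) g \<circ> (\<odot>) p) gunit =
      chart_deriv c d ((\<odot>) g) (p \<odot> gunit) \<circ> chart_deriv c0 c ((\<odot>) p) gunit"
    using * c0 by (intro chart_deriv_compose[OF smooth_atlas] chart_differentiable_left_mult) auto
  ultimately show "left_field v d (g \<odot> p) = chart_deriv c d ((\<odot>) g) p (left_field v c p)"
    using * by (simp add: left_field_chart_deriv)
qed

lemma left_invariant_eq_left_field:
  assumes "X \<in> left_invariant_fields (\<odot>) A"
  shows "X = left_field (X c0 gunit)"
proof (intro ext)
  fix c p
  show "X c p = left_field (X c0 gunit) c p"
  proof (cases "c \<in> A \<and> p \<in> fst c")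
    case True
    have "\<forall>g p. \<forall>c\<in>A. \<forall>d\<in>A. p \<in> fst c \<and> g \<odot> p \<in> fst d \<longrightarrow>
        X d (g \<odot> p) = chart_deriv c d ((\<odot>) g) p (X c p)"
      using assms by (simp add: left_invariant_fields_def)
    from this[rule_format, of c0 c gunit p] show ?thesis using True c0
      by (simp add: left_field_chart_deriv)
  next
    case False
    moreover have "\<forall>c p. \<not> (c \<in> A \<and> p \<in> fst c) \<longrightarrow> X c p = 0"
      using assms unfolding left_invariant_fields_def smooth_vector_field_def by blast
    ultimately show ?thesis unfolding left_field_def by presburger
  qed
qed

text \<open>Right translation by \<open>y\<close> after left translation by \<open>q\<close> equals
  left translation by \<open>q \<odot> y\<close> after conjugation by \<open>ginv y\<close>. At the
  unit the derivative of that conjugation is trivial.\<close>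

lemma left_field_right_mult:
  assumes "Ad y = id" "c \<in> A" "d \<in> A" "q \<in> fst c" "q \<odot> y \<in> fst d"
  shows "left_field w d (q \<odot> y) = chart_deriv c d (\<lambda>x. x \<odot> y) q (left_field w c q)"
proof -
  have Ad_inv: "Ad (ginv y) = id"
    using Ad_mult[of "ginv y" y] assms(1) by (simp add: Ad_unit)
  have "ginv (ginv y) = y" by simp
  then have *: "(\<lambda>x. x \<odot> y) \<circ> (\<odot>) q = (\<odot>) (q \<odot> y) \<circ> conj_by (ginv y)"
    by (simp add: fun_eq_iff conj_by_def assoc) (simp flip: assoc)
  have "chart_deriv c d (\<lambda>x. x \<odot> y) (q \<odot> gunit) \<circ> chart_deriv c0 c ((\<odot>) q) gunit
      = chart_deriv c0 d ((\<lambda>x. x \<odot> y) \<circ> (\<odot>) q) gunit"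
    using assms c0 by (intro chart_deriv_compose[OF smooth_atlas, symmetric]
        chart_differentiable_left_mult chart_differentiable_right_mult) auto
  also have "\<dots> = chart_deriv c0 d ((\<odot>) (q \<odot> y)) gunit \<circ> Ad (ginv y)"
    using assms c0 chart_deriv_compose[OF smooth_atlas c0(1) c0(1) assms(3) c0(2) _ _
        chart_differentiable_conj_by chart_differentiable_left_mult, of "ginv y" "q \<odot> y"]
    unfolding * Ad_def by (simp add: conj_by_unit)
  finally have "chart_deriv c d (\<lambda>x. x \<odot> y) q \<circ> chart_deriv c0 c ((\<odot>) q) gunit =
      chart_deriv c0 d ((\<odot>) (q \<odot> y)) gunit"
    by (simp add: Ad_inv)
  then show ?thesis
    using assms by (simp add: left_field_chart_deriv fun_eq_iff)
qed

text \<open>If \<open>Ad y\<close> is trivial, right translation by \<open>y\<close> preserves left-invariant fields. Differentiating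
  this along \<open>y n\<close> shows that the limit direction \<open>v\<close> is central.\<close>

lemma lie_bracket_left_field_limit_direction:
  assumes y: "\<And>n. y n \<in> fst c0" "\<And>n. y n \<noteq> gunit" "\<And>n. Ad (y n) = id"
    and lim: "(\<lambda>n. snd c0 (y n)) \<longlonglongrightarrow> snd c0 gunit"
    and v: "(\<lambda>n. (snd c0 (y n) - snd c0 gunit) /\<^sub>R norm (snd c0 (y n) - snd c0 gunit)) \<longlonglongrightarrow> v"
  shows "lie_bracket A (left_field w) (left_field (r *\<^sub>R v)) = 0"
proof (intro ext)
  fix c p
  show "lie_bracket A (left_field w) (left_field (r *\<^sub>R v)) c p = 0 c p"
  proof (cases "c \<in> A \<and> p \<in> fst c")
    case False
    then show ?thesis by (auto simp: lie_bracket_def)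
  next
    case True
    then have cA: "c \<in> A" and p: "p \<in> fst c" by auto
    note c = smooth_atlas_chartD[OF smooth_atlas cA] and ch0 = smooth_atlas_chartD[OF smooth_atlas c0(1)]
    define \<mu> where "\<mu> = mult_coords c c0 c"
    define S where "S = mult_dom c c0 c"
    define P where "P = (\<lambda>u z. frechet_derivative \<mu> (at z) u)"
    define P' where "P' = (\<lambda>u z. frechet_derivative (P u) (at z))"
    define x a where x_def: "x = snd c p" and a_def: "a = snd c0 gunit"
    define w' where "w' = left_field w c p"
    define v' where "v' = r *\<^sub>R v"
    have S: "open S" unfolding S_def by (rule open_mult_dom[OF cA c0(1) cA])
    have xaS: "(x, a) \<in> S"
      unfolding S_def x_def a_def using cA c0 p by (intro mem_mult_dom) auto
    have smooth: "smooth_on S \<mu>" unfolding S_def \<mu>_def by (rule smooth_on_mult_coords[OF cA c0(1) cA])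
    have P: "(\<mu> has_derivative (\<lambda>u. P u (x, a))) (at (x, a))"
      using smooth_onD(2)[OF smooth xaS] by (simp add: P_def)
    have P': "(P u has_derivative P' u (x, a)) (at (x, a))" for u
      unfolding P'_def P_def using smooth_onD(2)[OF smooth_onD(3)[OF smooth xaS] xaS] .
    have left_coords: "left_field u c q = P (0, u) (snd c q, a)" if "q \<in> fst c" for u q
      unfolding P_def \<mu>_def a_def by (rule left_field_mult_coords[OF cA that])

    have V_deriv: "((left_field u c \<circ> chart_inv c) has_derivative (\<lambda>h. P' (0, u) (x, a) (h, 0))) (at x)" for u
    proof -
      have "((\<lambda>x. (x, a)) has_derivative (\<lambda>h. (h, 0))) (at x)"
        by (auto intro!: derivative_eq_intros)
      from has_derivative_compose[OF this P'[of "(0, u)"]] show ?thesis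
        by (rule has_derivative_transform_within_open[OF _ c(2)])
          (use p c(6) left_coords in \<open>auto simp: x_def\<close>)
    qed
    define W where "W = left_field w c \<circ> chart_inv c"
    have W: "(W has_derivative frechet_derivative W (at x)) (at x)"
      using V_deriv[of w] unfolding W_def
      by (metis frechet_derivative_at)

    \<comment> \<open>With the base point \<open>x\<close> fixed, \<open>F z\<close> is the failure
      of the field of \<open>w\<close> to be preserved by right translation by the point with
      coordinates \<open>z\<close>. It vanishes wherever \<open>Ad\<close> is trivial and the
      product stays in the chart.\<close>
    define F where "F = (\<lambda>z. W (\<mu> (x, z)) - P (w', 0) (x, z))"
    have \<mu>_val: "\<mu> (x, snd c0 q) = snd c (p \<odot> q)" if "q \<in> fst c0" for q
      using that p c(6) ch0(6) by (simp add: \<mu>_def mult_coords_def x_def)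
    have F0: "F (snd c0 q) = 0" if "q \<in> fst c0" "Ad q = id" "p \<odot> q \<in> fst c" for q
    proof -
      have "P (w', 0) (x, snd c0 q) = chart_deriv c c (\<lambda>x. x \<odot> q) p w'"
        unfolding P_def \<mu>_def x_def using chart_deriv_right_mult[OF cA c0(1) cA p that(1,3)] by simp
      also have "\<dots> = left_field w c (p \<odot> q)"
        unfolding w'_def using left_field_right_mult[OF that(2) cA cA p that(3)] by simp
      finally show ?thesis
        using that c(6) by (simp add: F_def W_def \<mu>_val)
    qed
    \<comment> \<open>The first term differentiates the field of \<open>w\<close> along the
      left-invariant field of \<open>h\<close>; the second is a mixed second derivative of the
      multiplication.\<close>
    have F: "(F has_derivative (\<lambda>h. frechet_derivative W (at x) (P (0, h) (x, a)) - P' (w', 0) (x, a) (0, h))) (at a)"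
    proof -
      have sec: "((\<lambda>z. (x, z)) has_derivative (\<lambda>h. (0, h))) (at a)"
        by (auto intro!: derivative_eq_intros)
      have "\<mu> (x, a) = x"
        using \<mu>_val[OF c0(2)] by (simp add: a_def x_def)
      with W have "(W has_derivative frechet_derivative W (at x)) (at (\<mu> (x, a)))" by simp
      from has_derivative_compose[OF has_derivative_compose[OF sec P] this]
      show ?thesis unfolding F_def
        by (rule has_derivative_diff[OF _ has_derivative_compose[OF sec P']])
    qed
    have "frechet_derivative W (at x) (P (0, v) (x, a)) - P' (w', 0) (x, a) (0, v) = 0"
    proof (rule has_derivative_vanishes_along_sequence[OF F])
      show "F a = 0" unfolding a_def using c0 p Ad_unit by (intro F0) auto
      show "snd c0 (y n) \<noteq> a" for n
        unfolding a_def using y(1,2)[of n] c0(2) ch0(5) by (metis inj_onD)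
      show "(\<lambda>n. snd c0 (y n)) \<longlonglongrightarrow> a" unfolding a_def by (rule lim)
      show "(\<lambda>n. (snd c0 (y n) - a) /\<^sub>R norm (snd c0 (y n) - a)) \<longlonglongrightarrow> v"
        unfolding a_def by (rule v)
      \<comment> \<open>The product \<open>p \<odot> y n\<close> is known to lie in the domain of
        \<open>c\<close> only for large \<open>n\<close>, so the zeros of \<open>F\<close> are
        available only eventually.\<close>
      have "(\<lambda>n. (x, snd c0 (y n))) \<longlonglongrightarrow> (x, a)"
        unfolding a_def by (intro tendsto_intros lim)
      then have "\<forall>\<^sub>F n in sequentially. (x, snd c0 (y n)) \<in> S"
        using S xaS by (rule topological_tendstoD)
      then show "\<forall>\<^sub>F n in sequentially. F (snd c0 (y n)) = 0"
      proof eventually_elim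
        case (elim n)
        then have "p \<odot> y n \<in> fst c"
          using p y(1)[of n] c(6) ch0(6) by (auto simp: S_def mult_dom_def x_def)
        then show ?case using y by (intro F0) auto
      qed
    qed
    moreover have "P (0, v') (x, a) = r *\<^sub>R P (0, v) (x, a)"
      using linear_cmul[OF has_derivative_linear[OF P], of r "(0, v)"] by (simp add: v'_def)
    moreover have "P' (w', 0) (x, a) (0, v') = r *\<^sub>R P' (w', 0) (x, a) (0, v)"
      using linear_cmul[OF has_derivative_linear[OF P'], of _ r "(0, v)"] by (simp add: v'_def)
    ultimately have "frechet_derivative W (at x) (P (0, v') (x, a)) = P' (w', 0) (x, a) (0, v')"
      using linear_cmul[OF has_derivative_linear[OF W]] by simp
    \<comment> \<open>Exchanging the directions turns the mixed derivative into the derivative of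
      the field of \<open>v'\<close> along that of \<open>w\<close>, the other half of the
      bracket.\<close>
    moreover have "P' (w', 0) (x, a) (0, v') = P' (0, v') (x, a) (w', 0)"
      unfolding P'_def P_def
      using smooth by (intro frechet_derivative_commute[OF S xaS]) (simp add: smooth_on_def)
    moreover have "frechet_derivative (left_field v' c \<circ> chart_inv c) (at x) w' = P' (0, v') (x, a) (w', 0)"
      using fun_cong[OF frechet_derivative_at[OF V_deriv[of v']], of w'] by simp
    ultimately have "frechet_derivative (left_field v' c \<circ> chart_inv c) (at x) w' =
        frechet_derivative W (at x) (left_field v' c p)"
      using left_coords[OF p, of v'] by (simp add: x_def)
    then show ?thesis
      using True by (simp add: lie_bracket_def v'_def w'_def W_def x_def)
  qed
qed

text \<open>This is where semisimplicity enters. If kernel elements accumulated at the unit,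
  compactness of the unit sphere would give their normalised coordinates a limit \<open>v\<close> of
  norm 1, hence a nonzero central field.\<close>

lemma trivial_Ad_discrete:
  assumes "semisimple_lie_group (\<odot>) A"
  obtains U where "open U" "gunit \<in> U" "\<And>y. y \<in> U \<Longrightarrow> Ad y = id \<Longrightarrow> y = gunit"
proof (rule ccontr)
  assume "\<not> thesis"
  then have *: "\<exists>y\<in>U. Ad y = id \<and> y \<noteq> gunit" if "open U" "gunit \<in> U" for U
    using that \<open>\<And>U. \<lbrakk>open U; gunit \<in> U; \<And>y. \<lbrakk>y \<in> U; Ad y = id\<rbrakk> \<Longrightarrow> y = gunit\<rbrakk> \<Longrightarrow> thesis\<close> by blast
  note ch0 = smooth_atlas_chartD[OF smooth_atlas c0(1)]
  define a where "a = snd c0 gunit"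
  have "\<exists>y. y \<in> fst c0 \<and> dist (snd c0 y) a < 1 / Suc n \<and> Ad y = id \<and> y \<noteq> gunit" for n
  proof -
    have "open (fst c0 \<inter> snd c0 -` ball a (1 / Suc n))"
      by (intro continuous_open_preimage ch0 open_ball)
    moreover have "gunit \<in> fst c0 \<inter> snd c0 -` ball a (1 / Suc n)" using c0 by (simp add: a_def)
    ultimately show ?thesis using *[of "fst c0 \<inter> snd c0 -` ball a (1 / Suc n)"]
      by (auto simp: dist_commute)
  qed
  then obtain y where y: "\<And>n. y n \<in> fst c0" "\<And>n. dist (snd c0 (y n)) a < 1 / Suc n"
    "\<And>n. Ad (y n) = id" "\<And>n. y n \<noteq> gunit" by metis
  have ne: "snd c0 (y n) \<noteq> a" for n
    unfolding a_def using y(1,4)[of n] c0(2) ch0(5) by (metis inj_onD)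
  have lim: "(\<lambda>n. snd c0 (y n)) \<longlonglongrightarrow> a"
  proof (rule metric_tendsto_imp_tendsto[OF LIMSEQ_inverse_real_of_nat])
    show "\<forall>\<^sub>F n in sequentially. dist (snd c0 (y n)) a \<le> dist (inverse (real (Suc n))) 0"
      using less_imp_le[OF y(2)] by (simp add: inverse_eq_divide)
  qed
  define u where "u = (\<lambda>n. (snd c0 (y n) - a) /\<^sub>R norm (snd c0 (y n) - a))"
  have "u n \<in> sphere 0 1" for n using ne[of n] by (simp add: u_def)
  then obtain v s where v: "v \<in> sphere 0 1" "strict_mono s" "(u \<circ> s) \<longlonglongrightarrow> v"
    using compact_sphere unfolding compact_def by metis
  have bracket: "lie_bracket A (left_field w) (left_field (r *\<^sub>R v)) = 0" for w r
    using y v LIMSEQ_subseq_LIMSEQ[OF lim v(2)] unfolding a_def u_def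
    by (intro lie_bracket_left_field_limit_direction[of "y \<circ> s"]) (simp_all add: comp_def)
  \<comment> \<open>Brackets of arbitrary left-invariant fields with members of this line vanish.
    Hence it is an ideal, and its derived series reaches zero after one step.\<close>
  define I where "I = left_field ` span {v}"
  let ?L = "left_invariant_fields (\<odot>) A"
  have bracket_I: "lie_bracket A X Y = 0" if X: "X \<in> ?L" and "Y \<in> I" for X Y
  proof -
    obtain r where Y: "Y = left_field (r *\<^sub>R v)"
      using \<open>Y \<in> I\<close> unfolding I_def span_singleton by blast
    show ?thesis
      by (subst left_invariant_eq_left_field[OF X], unfold Y, rule bracket)
  qed
  have I: "I \<subseteq> ?L" using left_field_left_invariant by (auto simp: I_def)
  have "subspace I" unfolding I_def using linear_left_field by (rule linear_subspace_image) simp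
  then have "lie_ideal (lie_bracket A) ?L I"
    using I bracket_I subspace_0 by (auto simp: lie_ideal_def)
  moreover have "{lie_bracket A X Y |X Y. X \<in> I \<and> Y \<in> I} \<subseteq> {0}"
    using I bracket_I by blast
  then have "span {lie_bracket A X Y |X Y. X \<in> I \<and> Y \<in> I} = {0}"
    using span_minimal[OF _ subspace_single_0] span_0 by blast
  then have "derived_series (lie_bracket A) I 1 = {0}" by simp
  then have "lie_solvable (lie_bracket A) I" unfolding lie_solvable_def ..
  ultimately have "I = {0}"
    using assms by (simp add: semisimple_lie_group_def semisimple_lie_algebra_def)
  then have "left_field v = 0" by (auto simp: I_def intro: span_base)
  then have "chart_deriv c0 c0 ((\<odot>) gunit) gunit v = 0"
    using c0 by (simp flip: left_field_chart_deriv)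
  moreover have "(\<odot>) gunit = id" by (simp add: fun_eq_iff)
  ultimately have "v = 0" using chart_deriv_id[OF smooth_atlas c0] by simp
  with v(1) show False by simp
qed

end

section \<open>Stability\<close>

context lie_group_chart
begin

text \<open>By compactness finitely many of the trace functions already distinguish the unit from the shell \<open>B\<close>
  around it; the sum \<open>\<psi>\<close> of their defects is a barrier that orbits cannot cross.\<close>

lemma invariant_unit_neighbourhood:
  fixes \<phi> :: "real \<Rightarrow> 'g \<Rightarrow> 'g"
  assumes compact: "compact (UNIV :: 'g set)"
    and semisimple: "semisimple_lie_group (\<odot>) A"
    and aut: "\<And>t. lie_group_automorphism (\<odot>) A (\<phi> t)"
    and cont: "\<And>g. continuous_on UNIV (\<lambda>t. \<phi> t g)"
    and zero: "\<phi> 0 = id"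
    and V: "open V" "gunit \<in> V"
  obtains W where "open W" "gunit \<in> W" "\<And>x t. x \<in> W \<Longrightarrow> \<phi> t x \<in> V"
proof -
  obtain U where U: "open U" "gunit \<in> U" "\<And>y. y \<in> U \<Longrightarrow> Ad y = id \<Longrightarrow> y = gunit"
    using trivial_Ad_discrete[OF semisimple] by metis
  note ch0 = smooth_atlas_chartD[OF smooth_atlas c0(1)]
  define a where "a = snd c0 gunit"
  have "open {x \<in> snd c0 ` fst c0. chart_inv c0 x \<in> U \<inter> V}"
    by (intro open_chart_preimage[OF smooth_atlas c0(1)] open_Int U V)
  moreover have "a \<in> {x \<in> snd c0 ` fst c0. chart_inv c0 x \<in> U \<inter> V}"
    using U V c0 ch0(6) by (auto simp: a_def)
  ultimately obtain e where e: "e > 0" "cball a e \<subseteq> {x \<in> snd c0 ` fst c0. chart_inv c0 x \<in> U \<inter> V}"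
    by (auto simp: open_contains_cball)
  \<comment> \<open>The open and the closed coordinate ball around the unit, with the compact shell
    \<open>B\<close> between them. By the choice of \<open>e\<close>, all of it lies in
    \<open>U \<inter> V\<close>.\<close>
  define V' where "V' = fst c0 \<inter> snd c0 -` ball a e"
  define K where "K = chart_inv c0 ` cball a e"
  define B where "B = K - V'"
  have V': "open V'" "gunit \<in> V'"
    unfolding V'_def using c0 e(1) by (auto intro!: continuous_open_preimage ch0 simp: a_def)
  have "continuous_on (cball a e) (chart_inv c0)"
    using e(2) by (intro continuous_on_subset[OF ch0(4)]) auto
  then have K: "compact K" unfolding K_def by (intro compact_continuous_image compact_cball)
  have V'K: "V' \<subseteq> K"
  proof
    fix q assume "q \<in> V'"
    then have "q = chart_inv c0 (snd c0 q)" "snd c0 q \<in> cball a e" using ch0(6) by (auto simp: V'_def)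
    then show "q \<in> K" unfolding K_def by blast
  qed
  have KUV: "K \<subseteq> U \<inter> V" using e(2) by (auto simp: K_def)
  have B: "compact B" using K V'(1) by (simp add: B_def compact_diff)
  let ?n = "real DIM('e)"
  \<comment> \<open>The shell lies in \<open>U\<close> but avoids the unit, so \<open>Ad\<close> is
    nontrivial on it and some trace must differ from the dimension.\<close>
  have trace_ne: "\<exists>k. Ad_trace k x \<noteq> ?n" if "x \<in> B" for x
  proof (rule ccontr)
    assume "\<nexists>k. Ad_trace k x \<noteq> ?n"
    then have "Ad x = id" using Ad_eq_id_if_trace[OF compact] by blast
    then have "x = gunit" using U(3) KUV that by (auto simp: B_def)
    then show False using that V'(2) by (simp add: B_def)
  qed
  have "open {x. Ad_trace k x \<noteq> ?n}" for k
    by (intro open_Collect_neq continuous_on_Ad_trace continuous_on_const)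
  moreover have "B \<subseteq> (\<Union>k\<in>UNIV. {x. Ad_trace k x \<noteq> ?n})" using trace_ne by blast
  ultimately obtain N where N: "finite N" "B \<subseteq> (\<Union>k\<in>N. {x. Ad_trace k x \<noteq> ?n})"
    using compactE_image[OF B] by metis
  define \<psi> where "\<psi> = (\<lambda>x. \<Sum>k\<in>N. \<bar>Ad_trace k x - ?n\<bar>)"
  have cont_\<psi>: "continuous_on UNIV \<psi>"
    unfolding \<psi>_def by (intro continuous_intros continuous_on_Ad_trace)
  have pos: "\<psi> x > 0" if x: "x \<in> B" for x
  proof -
    obtain k where "k \<in> N" "Ad_trace k x \<noteq> ?n" using N x by auto
    then show ?thesis unfolding \<psi>_def using N(1) by (intro sum_pos2[of _ k]) auto
  qed
  have "\<exists>d>0. \<forall>x\<in>B. d \<le> \<psi> x"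
  proof (cases "B = {}")
    case False
    then obtain z where "z \<in> B" "\<forall>x\<in>B. \<psi> z \<le> \<psi> x"
      using continuous_attains_inf[OF B _ continuous_on_subset[OF cont_\<psi>]] by auto
    then show ?thesis using pos by auto
  qed (auto intro: exI[of _ 1])
  then obtain d where d: "d > 0" "\<And>x. x \<in> B \<Longrightarrow> d \<le> \<psi> x" by auto
  show thesis
  proof (rule that)
    show "open (V' \<inter> {x. \<psi> x < d})"
      by (intro open_Int V'(1) open_Collect_less cont_\<psi> continuous_on_const)
    show "gunit \<in> V' \<inter> {x. \<psi> x < d}"
      using V'(2) d(1) by (simp add: \<psi>_def Ad_trace_unit)
    fix x t assume x: "x \<in> V' \<inter> {x. \<psi> x < d}"
    let ?C = "range (\<lambda>t. \<phi> t x)"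
    have conn: "connected ?C"
      using cont by (intro connected_continuous_image connected_UNIV)
    \<comment> \<open>\<open>\<psi>\<close> keeps its starting value below \<open>d\<close> along
      the orbit, so the orbit misses the shell and is covered by the disjoint open sets
      \<open>V'\<close> and \<open>- K\<close>. Being connected and starting in \<open>V'\<close>,
      it never leaves \<open>K\<close>.\<close>
    have sub: "?C \<subseteq> V' \<union> - K"
    proof
      fix z assume "z \<in> ?C"
      then obtain s where z: "z = \<phi> s x" by auto
      have "\<psi> z = \<psi> x"
        by (simp add: z \<psi>_def Ad_trace_automorphism[OF aut])
      then have "z \<notin> B" using x d(2)[of z] by auto
      then show "z \<in> V' \<union> - K" by (auto simp: B_def)
    qed
    have openK: "open (- K)" using K by (simp add: compact_imp_closed open_Compl)
    have disj: "V' \<inter> - K \<inter> ?C = {}" using V'K by blast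
    have "V' \<inter> ?C = {} \<or> - K \<inter> ?C = {}"
      by (rule connectedD[OF conn V'(1) openK disj sub])
    moreover have "x \<in> V' \<inter> ?C" using x zero by (auto intro: range_eqI[of _ _ 0])
    ultimately have "?C \<subseteq> K" by blast
    then show "\<phi> t x \<in> V" using KUV by blast
  qed
qed

end

section \<open>From the unit to periodic orbits\<close>

lemma compact_periodic_orbit:
  fixes \<phi> :: "real \<Rightarrow> 'g \<Rightarrow> 'g::topological_space"
  assumes "periodic_orbit \<phi> \<Gamma>" "\<And>g. continuous_on UNIV (\<lambda>t. \<phi> t g)"
  shows "compact \<Gamma>"
proof -
  obtain g s where \<Gamma>: "\<Gamma> = range (\<lambda>t. \<phi> t g)" and s: "s > 0" "\<And>t. \<phi> (t + s) g = \<phi> t g"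
    using assms(1) by (auto simp: periodic_orbit_def)
  interpret periodic_fun_simple "\<lambda>t. \<phi> t g" s
    by standard (rule s(2))
  \<comment> \<open>Subtracting \<open>\<lfloor>t / s\<rfloor>\<close> periods moves any time into
    one closed period interval, so the orbit is a continuous image of a compact interval.\<close>
  have "\<phi> t g \<in> (\<lambda>t. \<phi> t g) ` {0..s}" for t
  proof -
    have "of_int \<lfloor>t / s\<rfloor> * s \<le> t" "t \<le> (of_int \<lfloor>t / s\<rfloor> + 1) * s"
      using s(1) by (simp_all flip: pos_le_divide_eq pos_divide_le_eq)
    then have "t - of_int \<lfloor>t / s\<rfloor> * s \<in> {0..s}"
      by (auto simp: algebra_simps)
    moreover have "\<phi> t g = \<phi> (t - of_int \<lfloor>t / s\<rfloor> * s) g"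
      by (rule minus_of_int[symmetric])
    ultimately show ?thesis by blast
  qed
  then have "\<Gamma> = (\<lambda>t. \<phi> t g) ` {0..s}" unfolding \<Gamma> by blast
  then show ?thesis
    using assms(2) by (auto intro!: compact_continuous_image intro: continuous_on_subset)
qed

context lie_group
begin

text \<open>The tube lemma makes one neighbourhood of the unit serve all points of \<open>K\<close>;
  the factors are swapped to put the compact set second.\<close>

lemma compact_mult_neighbourhood:
  assumes "compact K" "open V" "K \<subseteq> V"
  obtains U where "open U" "gunit \<in> U" "\<And>x u. x \<in> K \<Longrightarrow> u \<in> U \<Longrightarrow> x \<odot> u \<in> V"
proof -
  have "\<exists>U. gunit \<in> U \<and> open U \<and> U \<times> K \<subseteq> (\<lambda>z. snd z \<odot> fst z) -` V"
  proof (rule Elementary_Topology.tube_lemma[OF assms(1)])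
    show "open ((\<lambda>z. snd z \<odot> fst z) -` V)"
      by (intro open_vimage assms(2) continuous_intros)
    show "{gunit} \<times> K \<subseteq> (\<lambda>z. snd z \<odot> fst z) -` V"
      using assms(3) by auto
  qed
  then obtain U where "open U" "gunit \<in> U" "U \<times> K \<subseteq> (\<lambda>z. snd z \<odot> fst z) -` V" by blast
  then show ?thesis by (intro that[of U]) auto
qed

end

theorem theorem3p11:
  fixes gmult :: "'g::{second_countable_topology, t2_space} \<Rightarrow> 'g \<Rightarrow> 'g"
    and gunit :: 'g
    and ginv :: "'g \<Rightarrow> 'g"
    and A :: "('g, 'e::euclidean_space) chart set"
    and X :: "('g, 'e) vfield"
    and \<phi> :: "real \<Rightarrow> 'g \<Rightarrow> 'g"
  assumes "lie_group gmult gunit ginv A"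
    and "connected (UNIV :: 'g set)"
    and "compact (UNIV :: 'g set)"
    and "semisimple_lie_group gmult A"
    and "linear_vector_field gmult A X"
    and "linear_flow gmult A X \<phi>"
  shows "\<forall>\<Gamma>. periodic_orbit \<phi> \<Gamma> \<longrightarrow> stable_orbit \<phi> \<Gamma>"
proof (intro allI impI)
  fix \<Gamma> assume \<Gamma>: "periodic_orbit \<phi> \<Gamma>"
  interpret lie_group gmult gunit ginv A by fact
  obtain c0 where "c0 \<in> A" "gunit \<in> fst c0" using smooth_atlas_chart_at[OF smooth_atlas] .
  then interpret lie_group_chart gmult gunit ginv A c0 by unfold_locales
  have zero: "\<phi> 0 = id" and add: "\<phi> (s + t) = \<phi> s \<circ> \<phi> t"
    and cont: "continuous_on UNIV (\<lambda>t. \<phi> t g)" and aut: "lie_group_automorphism gmult A (\<phi> t)" for s t g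
    using assms(6) by (auto simp: linear_flow_def flow_of_def integral_curve_def)
  have hom: "\<phi> t (gmult x y) = gmult (\<phi> t x) (\<phi> t y)" for t x y
    using aut by (simp add: lie_group_automorphism_def)
  have invariant: "\<phi> t p \<in> \<Gamma>" if "p \<in> \<Gamma>" for t p
  proof -
    obtain g where \<Gamma>_eq: "\<Gamma> = range (\<lambda>t. \<phi> t g)"
      using \<Gamma> unfolding periodic_orbit_def by blast
    then obtain s where "p = \<phi> s g" using \<open>p \<in> \<Gamma>\<close> by blast
    then have "\<phi> t p = \<phi> (t + s) g" by (simp add: add)
    then show ?thesis by (simp add: \<Gamma>_eq)
  qed
  show "stable_orbit \<phi> \<Gamma>"
    unfolding stable_orbit_def
  proof (intro allI impI, elim conjE)
    fix V assume V: "open V" "\<Gamma> \<subseteq> V"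
    obtain U where U: "open U" "gunit \<in> U" "\<And>x u. x \<in> \<Gamma> \<Longrightarrow> u \<in> U \<Longrightarrow> gmult x u \<in> V"
      using compact_mult_neighbourhood[OF compact_periodic_orbit[OF \<Gamma> cont] V] by blast
    obtain W where W: "open W" "gunit \<in> W" "\<And>x t. x \<in> W \<Longrightarrow> \<phi> t x \<in> U"
      using invariant_unit_neighbourhood[OF assms(3,4) aut cont zero U(1,2)] by blast
    \<comment> \<open>A union of left translates of \<open>W\<close> by points \<open>p\<close> of
      the orbit. For \<open>x = p \<odot> w\<close>, the automorphism property splits
      \<open>\<phi> t x\<close> into \<open>\<phi> t p\<close>, which stays on
      \<open>\<Gamma>\<close>, and \<open>\<phi> t w\<close>, which stays in \<open>U\<close>; their
      product lies in \<open>V\<close>.\<close>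
    define W' where "W' = (\<Union>p\<in>\<Gamma>. {x. gmult (ginv p) x \<in> W})"
    have stays: "\<phi> t x \<in> V" if x: "x \<in> W'" for t x
    proof -
      obtain p where p: "p \<in> \<Gamma>" "gmult (ginv p) x \<in> W" using x by (auto simp: W'_def)
      have "x = gmult p (gmult (ginv p) x)" by (simp flip: assoc)
      then have "\<phi> t x = gmult (\<phi> t p) (\<phi> t (gmult (ginv p) x))" using hom by metis
      then show ?thesis using U(3)[OF invariant[OF p(1)] W(3)[OF p(2)]] by simp
    qed
    have "open (gmult (ginv p) -` W)" for p
      by (intro open_vimage W(1) continuous_intros)
    then have "open W'" unfolding W'_def by (intro open_UN) (auto simp: vimage_def)
    moreover have "\<Gamma> \<subseteq> W'" using W(2) by (auto simp: W'_def)
    moreover have "W' \<subseteq> V" using stays[of _ 0] by (auto simp: zero)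
    ultimately show "\<exists>W. open W \<and> \<Gamma> \<subseteq> W \<and> W \<subseteq> V \<and> (\<forall>x\<in>W. \<forall>t\<ge>0. \<phi> t x \<in> V)"
      using stays by blast
  qed
qed

end
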